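(* Let $X$ be a locally convex space, $p$ a continuous seminorm on $X$, $D$ a Banach disk in $X$, and $A,B$ countable subsets of $X$ such that both $A$ and $B$ are $p$-independent and both $A$ and $B$ are contained in and dense in the Banach space $(X_D,p_D)$. Then there exists $J\in GL(X)$ such that $J(A)=B$ and $Jx=x$ for every $x\in\ker p=\{x\in X:p(x)=0\}$.
   Context: Spaces are Hausdorff, over $\mathbb{K}\in\{\mathbb{R},\mathbb{C}\}$; "countable" means infinite countable. $GL(X)$ is the group of continuous linear bijections of $X$ with continuous inverse. A disk in a locally convex space $X$ is a bounded, convex, balanced subset $D$; $X_D$ denotes $\mathrm{span}(D)$ with the norm $p_D$, the Minkowski functional of $D$; $D$ is a Banach disk if $(X_D,p_D)$ is complete. For a seminorm $p$ on $X$, a set $A\subseteq X$ is $p$-independent if $p(z_1a_1+\dots+z_na_n)\neq0$ for every $n\in\mathbb{N}$, pairwise distinct $a_1,\dots,a_n\in A$ and nonzero $z_1,\dots,z_n\in\mathbb{K}$ (equivalently, the classes $a+\ker p$, $a\in A$, are linearly independent in $X/\ker p$). *)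

theory Defs
  imports "HOL-Analysis.Analysis"
begin

text \<open>Scalar field: a type 'k of class real_normed_field (R or C); the space X is a type 'a
with an abstract scalar multiplication sc :: 'k => 'a => 'a.\<close>

definition sc_convex :: "('k::real_normed_field \<Rightarrow> 'a::ab_group_add \<Rightarrow> 'a) \<Rightarrow> 'a set \<Rightarrow> bool" where
  "sc_convex sc S \<longleftrightarrow> (\<forall>x\<in>S. \<forall>y\<in>S. \<forall>t::real. 0 \<le> t \<and> t \<le> 1 \<longrightarrow>
      sc (of_real t) x + sc (of_real (1 - t)) y \<in> S)"

definition sc_balanced :: "('k::real_normed_field \<Rightarrow> 'a::ab_group_add \<Rightarrow> 'a) \<Rightarrow> 'a set \<Rightarrow> bool" where
  "sc_balanced sc S \<longleftrightarrow> (\<forall>c. norm c \<le> 1 \<longrightarrow> sc c ` S \<subseteq> S)"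

definition lcs :: "('k::real_normed_field \<Rightarrow> 'a::{ab_group_add,t2_space} \<Rightarrow> 'a) \<Rightarrow> bool" where
  "lcs sc \<longleftrightarrow> vector_space sc
     \<and> continuous_on UNIV (\<lambda>z::'a \<times> 'a. fst z + snd z)
     \<and> continuous_on UNIV (\<lambda>z::'k \<times> 'a. sc (fst z) (snd z))
     \<and> (\<forall>U. open U \<and> 0 \<in> U \<longrightarrow> (\<exists>V. open V \<and> 0 \<in> V \<and> V \<subseteq> U \<and> sc_convex sc V))"

definition seminorm :: "('k::real_normed_field \<Rightarrow> 'a::ab_group_add \<Rightarrow> 'a) \<Rightarrow> ('a \<Rightarrow> real) \<Rightarrow> bool" where
  "seminorm sc p \<longleftrightarrow> (\<forall>x y. p (x + y) \<le> p x + p y) \<and> (\<forall>c x. p (sc c x) = norm c * p x)"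

definition tvs_bounded :: "('k::real_normed_field \<Rightarrow> 'a::{ab_group_add,topological_space} \<Rightarrow> 'a) \<Rightarrow> 'a set \<Rightarrow> bool" where
  "tvs_bounded sc S \<longleftrightarrow> (\<forall>U. open U \<and> 0 \<in> U \<longrightarrow>
      (\<exists>s>0. \<forall>t::real. t > s \<longrightarrow> S \<subseteq> sc (of_real t) ` U))"

definition disk :: "('k::real_normed_field \<Rightarrow> 'a::{ab_group_add,topological_space} \<Rightarrow> 'a) \<Rightarrow> 'a set \<Rightarrow> bool" where
  "disk sc D \<longleftrightarrow> tvs_bounded sc D \<and> sc_convex sc D \<and> sc_balanced sc D"

definition minkowski :: "('k::real_normed_field \<Rightarrow> 'a \<Rightarrow> 'a) \<Rightarrow> 'a set \<Rightarrow> 'a \<Rightarrow> real" where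
  "minkowski sc D x = Inf {t::real. t > 0 \<and> x \<in> sc (of_real t) ` D}"

definition banach_disk :: "('k::real_normed_field \<Rightarrow> 'a::{ab_group_add,topological_space} \<Rightarrow> 'a) \<Rightarrow> 'a set \<Rightarrow> bool" where
  "banach_disk sc D \<longleftrightarrow> disk sc D \<and>
     (\<forall>f::nat \<Rightarrow> 'a. (\<forall>n. f n \<in> module.span sc D) \<and>
        (\<forall>e>0. \<exists>N. \<forall>m\<ge>N. \<forall>n\<ge>N. minkowski sc D (f m - f n) < e) \<longrightarrow>
        (\<exists>x\<in>module.span sc D. (\<lambda>n. minkowski sc D (f n - x)) \<longlonglongrightarrow> 0))"

definition p_independent :: "('k::real_normed_field \<Rightarrow> 'a::ab_group_add \<Rightarrow> 'a) \<Rightarrow> ('a \<Rightarrow> real) \<Rightarrow> 'a set \<Rightarrow> bool" where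
  "p_independent sc p A \<longleftrightarrow> (\<forall>S z. finite S \<and> S \<noteq> {} \<and> S \<subseteq> A \<and> (\<forall>a\<in>S. z a \<noteq> 0) \<longrightarrow>
      p (\<Sum>a\<in>S. sc (z a) a) \<noteq> 0)"

definition dense_in_XD :: "('k::real_normed_field \<Rightarrow> 'a::ab_group_add \<Rightarrow> 'a) \<Rightarrow> 'a set \<Rightarrow> 'a set \<Rightarrow> bool" where
  "dense_in_XD sc D A \<longleftrightarrow> A \<subseteq> module.span sc D \<and>
     (\<forall>x\<in>module.span sc D. \<forall>e>0. \<exists>a\<in>A. minkowski sc D (x - a) < e)"

definition in_GL :: "('k::real_normed_field \<Rightarrow> 'a::{ab_group_add,topological_space} \<Rightarrow> 'a) \<Rightarrow> ('a \<Rightarrow> 'a) \<Rightarrow> bool" where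
  "in_GL sc J \<longleftrightarrow> Vector_Spaces.linear sc sc J \<and> bij J \<and> continuous_on UNIV J \<and> continuous_on UNIV (inv J)"

end

theory Submission
  imports Defs
begin

text \<open>The map is J x = x + T x, where T x = \<Sum>k. f k x u k with u k in span D, the functionals f k are bounded by
  multiples of p, and q (T x) \<le> c p x for the Minkowski functional q of D, with c so small that J is invertible by a Neumann
  iteration; such a map is continuous together with its inverse and fixes ker p. The summands are chosen by
  back and forth: having matched finitely many points of A with points of B, one more point of A (or of B)
  is matched by a rank-one correction with a functional that vanishes on the points already treated;
  by density of B (or A) the vector u k can be taken arbitrarily small.

  The functionals come from the Hahn--Banach theorem over the scalar field. Since the field is only assumed to be
  a real normed field, Ostrowski's theorem is needed to know that it is \<real> or \<complex>.\<close>

subsection \<open>Real normed fields\<close>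

text \<open>Measuring T from \<open>p\<close> to the norm \<open>q\<close> of X_D shapes the
  argument. \<open>X\<close> itself need not be complete, but the range of T lies in X_D, where the
  iteration converges. With p \<le> C q on X_D, a bound c gives the contraction constant c C there;
  c may therefore grow along the construction as long as c C stays below 1.

  The obstacle is the asymmetry between A and B. To reach a given b one corrects at the preimage y
  of b, which need not lie in A; a nearby point a of A is sent to b instead. The functional with f y
  = 1 exists only if y is p-independent of the points already treated. This is read off from B: the
  current map sends those points and y into B injectively and preserves ker p.

  Treated points keep their images for good. Convergence alone would not ensure that the limit map
  sends A into B.\<close>

text \<open>Put b = Y ^ 2 + t and n = 2 ^ k. Apart from b - c, the factors b ^ (n div 2 ^ i) + c ^ (n div 2 ^ i)
  of b ^ n - c ^ n have squares that are products of nonnegative real quadratics in Y, hence norm (b - c) * m ^ (n - 1) \<le> m ^ n + \<bar>c\<bar> ^ n; now let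
  k tend to infinity.\<close>

lemma ostrowski_norm_shift:
  fixes Y :: "'k::real_normed_field" and t c m :: real
  assumes min: "\<And>u v. 0 \<le> v \<Longrightarrow> m \<le> norm ((Y + of_real u)\<^sup>2 + of_real v)"
    and t: "0 \<le> t" "norm (Y\<^sup>2 + of_real t) = m" and c: "\<bar>c\<bar> < m"
  shows "norm (Y\<^sup>2 + of_real t - of_real c) \<le> m"
proof -
  define b where "b = Y\<^sup>2 + of_real t"
  define d :: 'k where "d = of_real c"
  have m: "0 < m" using c by linarith
  have base: "m\<^sup>2 \<le> norm (b\<^sup>2 + of_real s * (b * d) + d\<^sup>2)" if s: "\<bar>s\<bar> \<le> 2" for s :: real
  proof -
    \<comment> \<open>At Z = Y^2 the expression is Z^2 + \<beta> Z + \<gamma>, with discriminant at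
      most 0. If g^2 = \<gamma>, it equals (Y^2 + g)^2 - (2 g - \<beta>) Y^2, a difference of
      squares. Each factor is a shifted square plus v \<ge> 0, so the minimality of \<open>m\<close>
      applies to it.\<close>
    define \<gamma> where "\<gamma> = t\<^sup>2 + s * c * t + c\<^sup>2"
    define \<beta> where "\<beta> = 2 * t + s * c"
    have "\<beta>\<^sup>2 = 4 * \<gamma> - (4 - s\<^sup>2) * c\<^sup>2"
      unfolding \<beta>_def \<gamma>_def by (simp add: power2_eq_square algebra_simps)
    moreover have "s\<^sup>2 \<le> 4" using s abs_le_square_iff[of s 2] by simp
    ultimately have disc: "\<beta>\<^sup>2 \<le> 4 * \<gamma>" by simp
    then have "0 \<le> \<gamma>" using zero_le_power2[of \<beta>] by linarith
    define g where "g = sqrt \<gamma>"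
    have g: "0 \<le> g" "g\<^sup>2 = \<gamma>" using \<open>0 \<le> \<gamma>\<close> by (auto simp: g_def)
    have "\<beta>\<^sup>2 \<le> (2 * g)\<^sup>2" using disc g by (simp add: power_mult_distrib)
    then have \<beta>: "\<bar>\<beta>\<bar> \<le> 2 * g" using g abs_le_square_iff[of \<beta> "2 * g"] by simp
    define w where "w = sqrt (2 * g - \<beta>)"
    have w: "w\<^sup>2 = 2 * g - \<beta>" using \<beta> by (simp add: w_def)
    define v where "v = (2 * g + \<beta>) / 4"
    have v: "0 \<le> v" "w\<^sup>2 / 4 + v = g" using \<beta> w by (auto simp: v_def field_simps)
    define P Q :: 'k where "P = Y\<^sup>2 + of_real w * Y + of_real g" and "Q = Y\<^sup>2 - of_real w * Y + of_real g"
    have v': "of_real g = (of_real w)\<^sup>2 / 4 + (of_real v :: 'k)"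
      using v(2) by (metis of_real_add of_real_divide of_real_numeral of_real_power)
    have P: "P = (Y + of_real (w / 2))\<^sup>2 + of_real v" and Q: "Q = (Y + of_real (- w / 2))\<^sup>2 + of_real v"
      unfolding P_def Q_def v' by (simp_all add: power2_eq_square field_simps)
    have "P * Q = (Y\<^sup>2)\<^sup>2 + of_real (2 * g - w\<^sup>2) * Y\<^sup>2 + of_real (g\<^sup>2)"
      unfolding P_def Q_def by (simp add: power2_eq_square algebra_simps)
    also have "\<dots> = b\<^sup>2 + of_real s * (b * d) + d\<^sup>2"
      unfolding w g b_def d_def \<gamma>_def \<beta>_def by (simp add: power2_eq_square algebra_simps)
    finally have "norm (b\<^sup>2 + of_real s * (b * d) + d\<^sup>2) = norm P * norm Q"
      by (metis norm_mult)
    moreover have "m \<le> norm P" "m \<le> norm Q" unfolding P Q using min v(1) by blast+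
    ultimately show ?thesis using m by (simp add: power2_eq_square mult_mono)
  qed
  \<comment> \<open>Quantifying over s in [-2, 2] closes the induction: the expression for s splits
    into those for r and -r one level down, where r^2 = 2 - s, and again |r| \<le> 2. The value s =
    2 gives a perfect square.\<close>
  have quad: "(m ^ 2 ^ k)\<^sup>2 \<le> norm ((b ^ 2 ^ k)\<^sup>2 + of_real s * (b ^ 2 ^ k * d ^ 2 ^ k) + (d ^ 2 ^ k)\<^sup>2)"
    if "\<bar>s\<bar> \<le> 2" for s :: real and k
    using that
  proof (induction k arbitrary: s)
    case 0
    then show ?case using base by simp
  next
    case (Suc k)
    define r where "r = sqrt (2 - s)"
    have r: "r\<^sup>2 = 2 - s" using Suc.prems by (simp add: r_def)
    have "r\<^sup>2 \<le> 2\<^sup>2" using r Suc.prems by simp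
    then have r2: "\<bar>r\<bar> \<le> 2" using abs_le_square_iff[of r 2] by simp
    define x y where "x = b ^ 2 ^ k" and "y = d ^ 2 ^ k"
    have *: "b ^ 2 ^ Suc k = x\<^sup>2" "d ^ 2 ^ Suc k = y\<^sup>2" "m ^ 2 ^ Suc k = (m ^ 2 ^ k)\<^sup>2"
      by (simp_all add: x_def y_def power_mult mult.commute flip: power_mult)
    have s: "of_real s = 2 - (of_real r :: 'k)\<^sup>2"
      using r by (metis add_diff_cancel_left' diff_add_cancel of_real_diff of_real_numeral of_real_power diff_diff_eq2)
    have "(x\<^sup>2)\<^sup>2 + of_real s * (x\<^sup>2 * y\<^sup>2) + (y\<^sup>2)\<^sup>2
       = (x\<^sup>2 + of_real r * (x * y) + y\<^sup>2) * (x\<^sup>2 + of_real (- r) * (x * y) + y\<^sup>2)"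
      unfolding s by (simp add: power2_eq_square algebra_simps)
    moreover have le: "(m ^ 2 ^ k)\<^sup>2 \<le> norm (x\<^sup>2 + of_real r * (x * y) + y\<^sup>2)"
      "(m ^ 2 ^ k)\<^sup>2 \<le> norm (x\<^sup>2 + of_real (- r) * (x * y) + y\<^sup>2)"
      using Suc.IH[of r] Suc.IH[of "- r"] r2 unfolding x_def y_def by simp_all
    moreover have "((m ^ 2 ^ k)\<^sup>2)\<^sup>2
        \<le> norm (x\<^sup>2 + of_real r * (x * y) + y\<^sup>2) * norm (x\<^sup>2 + of_real (- r) * (x * y) + y\<^sup>2)"
      unfolding power2_eq_square[of "(m ^ 2 ^ k)\<^sup>2"] using le by (intro mult_mono) simp_all
    ultimately show ?case unfolding * by (simp only: norm_mult)
  qed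
  have plus: "m ^ 2 ^ k \<le> norm (b ^ 2 ^ k + d ^ 2 ^ k)" for k
  proof -
    have "(m ^ 2 ^ k)\<^sup>2 \<le> norm ((b ^ 2 ^ k + d ^ 2 ^ k)\<^sup>2)"
      using quad[of 2 k] by (simp only: power2_sum) (simp add: add_ac mult.assoc)
    then show ?thesis unfolding norm_power[of _ 2] by (rule power2_le_imp_le) simp
  qed
  have minus: "norm (b - d) * m ^ 2 ^ k \<le> norm (b ^ 2 ^ k - d ^ 2 ^ k) * m" for k
  proof (induction k)
    case (Suc k)
    have "norm (b - d) * m ^ 2 ^ Suc k = norm (b - d) * m ^ 2 ^ k * m ^ 2 ^ k"
      by (simp add: mult_2 power_add)
    also have "\<dots> \<le> norm (b ^ 2 ^ k - d ^ 2 ^ k) * m * norm (b ^ 2 ^ k + d ^ 2 ^ k)"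
      using m by (intro mult_mono[OF Suc plus]) auto
    also have "\<dots> = norm ((b ^ 2 ^ k - d ^ 2 ^ k) * (b ^ 2 ^ k + d ^ 2 ^ k)) * m"
      by (simp add: norm_mult)
    also have "(b ^ 2 ^ k - d ^ 2 ^ k) * (b ^ 2 ^ k + d ^ 2 ^ k) = b ^ 2 ^ Suc k - d ^ 2 ^ Suc k"
      by (simp add: mult_2 power_add algebra_simps)
    finally show ?case .
  qed simp
  have le: "norm (b - d) \<le> m + m * (\<bar>c\<bar> / m) ^ 2 ^ k" for k
  proof -
    have "norm (b ^ 2 ^ k - d ^ 2 ^ k) \<le> m ^ 2 ^ k + \<bar>c\<bar> ^ 2 ^ k"
      using norm_triangle_ineq4[of "b ^ 2 ^ k" "d ^ 2 ^ k"] t(2)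
      by (simp add: norm_power b_def d_def)
    then have "norm (b ^ 2 ^ k - d ^ 2 ^ k) * m \<le> (m ^ 2 ^ k + \<bar>c\<bar> ^ 2 ^ k) * m"
      using m by simp
    with minus[of k] have "norm (b - d) * m ^ 2 ^ k \<le> (m ^ 2 ^ k + \<bar>c\<bar> ^ 2 ^ k) * m"
      by linarith
    then show ?thesis using m by (simp add: field_simps)
  qed
  have "(\<lambda>k. m + m * (\<bar>c\<bar> / m) ^ 2 ^ k) \<longlonglongrightarrow> m + m * 0"
  proof (intro tendsto_intros)
    have "(\<lambda>n. (\<bar>c\<bar> / m) ^ n) \<longlonglongrightarrow> 0" using c m by (intro LIMSEQ_power_zero) auto
    moreover have "strict_mono (\<lambda>k. 2 ^ k :: nat)" by (simp add: strict_mono_def)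
    ultimately show "(\<lambda>k. (\<bar>c\<bar> / m) ^ 2 ^ k) \<longlonglongrightarrow> 0"
      using LIMSEQ_subseq_LIMSEQ unfolding o_def by fastforce
  qed
  then have "norm (b - d) \<le> m + m * 0"
    using le by (intro LIMSEQ_le_const) auto
  then show ?thesis by (simp add: b_def d_def)
qed

text \<open>Minimise the norm of (a - x)^2 + y^2 over the real plane. If the minimum m were
  positive, \<open>ostrowski_norm_shift\<close> would let the constant term grow in steps of m/2
  with the norm fixed at m, which is absurd for large constants.\<close>

lemma real_normed_field_quadratic:
  fixes a :: "'k::real_normed_field"
  obtains x y :: real where "(a - of_real x)\<^sup>2 + of_real (y\<^sup>2) = 0"
proof -
  define N where "N = (\<lambda>z::real \<times> real. norm ((a - of_real (fst z))\<^sup>2 + of_real ((snd z)\<^sup>2)))"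
  define K where "K = cball (0 :: real \<times> real) (3 * norm a)"
  have "continuous_on K N" unfolding N_def by (intro continuous_intros)
  moreover have "compact K" "K \<noteq> {}" by (auto simp: K_def)
  ultimately obtain z where z: "z \<in> K" "\<And>w. w \<in> K \<Longrightarrow> N z \<le> N w"
    by (meson continuous_attains_inf)
  \<comment> \<open>For r \<ge> 3 |a| the term r^2 exceeds 2 r |a| + |a|^2 by at least |a|^2, the
    value of N at 0. Hence the minimum over the ball is global.\<close>
  have far: "N 0 \<le> N w" if "w \<notin> K" for w
  proof -
    obtain x y where w: "w = (x, y)" by fastforce
    define r A where "r = norm w" and "A = norm a"
    have r: "3 * A \<le> r" "0 \<le> A" using that by (auto simp: K_def r_def A_def)
    have xr: "\<bar>x\<bar> \<le> r" "r\<^sup>2 = x\<^sup>2 + y\<^sup>2"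
      using norm_fst_le[of x y] by (auto simp: r_def w norm_Pair)
    have "of_real (r\<^sup>2) = ((a - of_real x)\<^sup>2 + of_real (y\<^sup>2)) + of_real (2 * x) * a - a\<^sup>2"
      unfolding xr(2) by (simp add: power2_eq_square algebra_simps)
    also have "norm \<dots> \<le> norm ((a - of_real x)\<^sup>2 + of_real (y\<^sup>2)) + norm (of_real (2 * x) * a) + norm (a\<^sup>2)"
      by (intro order_trans[OF norm_triangle_ineq4] add_right_mono norm_triangle_ineq)
    finally have "norm (of_real (r\<^sup>2) :: 'k) \<le> N w + norm (of_real (2 * x) * a) + norm (a\<^sup>2)"
      by (simp add: N_def w)
    then have "r * r \<le> N w + 2 * (\<bar>x\<bar> * A) + A * A"
      by (simp add: norm_mult norm_power A_def power2_eq_square)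
    moreover have "\<bar>x\<bar> * A \<le> r * A" using xr r by (simp add: mult_right_mono)
    moreover have "(3 * A) * A \<le> r * (r - 2 * A)" using r by (intro mult_mono) auto
    then have "3 * (A * A) + 2 * (r * A) \<le> r * r" by (simp add: algebra_simps)
    ultimately have "A * A \<le> N w" using zero_le_square[of A] by linarith
    then show ?thesis by (simp add: N_def A_def norm_mult power2_eq_square)
  qed
  have min: "N z \<le> N w" for w
  proof -
    have "0 \<in> K" by (simp add: K_def)
    then show ?thesis using z(2) far[of w] by (meson order_trans)
  qed
  define m Y where "m = N z" and "Y = a - of_real (fst z)"
  have "m = 0"
  proof (rule ccontr)
    assume "m \<noteq> 0"
    then have m: "0 < m" by (simp add: m_def N_def)
    have minY: "m \<le> norm ((Y + of_real u)\<^sup>2 + of_real v)" if "0 \<le> v" for u v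
      using min[of "(fst z - u, sqrt v)"] that by (simp add: m_def N_def Y_def algebra_simps flip: of_real_power)
    define \<tau> where "\<tau> n = (snd z)\<^sup>2 + real n * (m / 2)" for n
    have \<tau>: "0 \<le> \<tau> n" for n using m by (simp add: \<tau>_def)
    have eq: "norm (Y\<^sup>2 + of_real (\<tau> n)) = m" for n
    proof (induction n)
      case 0
      then show ?case by (simp add: \<tau>_def m_def N_def Y_def)
    next
      case (Suc n)
      \<comment> \<open>The shift lemma with c = -m/2 gives only \<le> m; minimality restores
        equality, so the step can be repeated.\<close>
      have "norm (Y\<^sup>2 + of_real (\<tau> n) - of_real (- (m / 2))) \<le> m"
        using minY \<tau> Suc m by (intro ostrowski_norm_shift) auto
      then have "norm (Y\<^sup>2 + of_real (\<tau> (Suc n))) \<le> m"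
        by (simp add: \<tau>_def algebra_simps add_divide_distrib)
      with minY[of "\<tau> (Suc n)" 0] \<tau> show ?case by (simp add: order_antisym)
    qed
    obtain n where n: "2 * (m + norm (Y\<^sup>2)) < real n * m"
      using m reals_Archimedean3 by blast
    have "\<tau> n = norm ((Y\<^sup>2 + of_real (\<tau> n)) - Y\<^sup>2)" using \<tau> by simp
    also have "\<dots> \<le> m + norm (Y\<^sup>2)"
      using norm_triangle_ineq4[of "Y\<^sup>2 + of_real (\<tau> n)" "Y\<^sup>2"] unfolding eq .
    finally have "\<tau> n \<le> m + norm (Y\<^sup>2)" .
    moreover have "real n * (m / 2) \<le> \<tau> n" by (simp add: \<tau>_def)
    ultimately show False using n by simp
  qed
  then show thesis using that[of "fst z" "snd z"] by (simp add: m_def N_def)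
qed

text \<open>The relation (c - x)^2 = -y^2 decides both cases. Given a root i of -1, it reads (c -
  x)^2 = (i y)^2 and factors; if there is none, y \<noteq> 0 would make (c - x)/y one.\<close>

lemma real_normed_field_cases [case_names real complex]:
  obtains "\<And>c::'k::real_normed_field. c \<in> \<real>"
  | i :: "'k::real_normed_field" where "i\<^sup>2 = -1" "\<And>c. \<exists>x y. c = of_real x + i * of_real y"
proof (cases "\<exists>i::'k. i\<^sup>2 = -1")
  case True
  then obtain i :: 'k where i: "i\<^sup>2 = -1" by blast
  have "\<exists>x y. c = of_real x + i * of_real y" for c
  proof -
    obtain x y where xy: "(c - of_real x)\<^sup>2 + of_real (y\<^sup>2) = 0"
      by (rule real_normed_field_quadratic)
    then have "(c - of_real x)\<^sup>2 = (i * of_real y)\<^sup>2"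
      by (simp add: power_mult_distrib i add_eq_0_iff2)
    then have "c - of_real x = i * of_real y \<or> c - of_real x = - (i * of_real y)"
      by (simp add: power2_eq_iff)
    then have "c = of_real x + i * of_real y \<or> c = of_real x + i * of_real (- y)"
      by (auto simp: algebra_simps)
    then show ?thesis by blast
  qed
  with i that show thesis by blast
next
  case False
  have "c \<in> \<real>" for c :: 'k
  proof -
    obtain x y where xy: "(c - of_real x)\<^sup>2 + of_real (y\<^sup>2) = 0"
      by (rule real_normed_field_quadratic)
    have "y = 0"
    proof (rule ccontr)
      assume "y \<noteq> 0"
      moreover have "(c - of_real x)\<^sup>2 = - (of_real y)\<^sup>2"
        using xy by (simp add: eq_neg_iff_add_eq_0)
      ultimately have "((c - of_real x) / of_real y)\<^sup>2 = -1"
        by (simp add: power_divide)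
      with False show False by blast
    qed
    with xy have "c = of_real x" by simp
    then show ?thesis by simp
  qed
  with that show thesis by blast
qed

subsection \<open>Hahn--Banach\<close>

definition sublinear :: "('k::real_normed_field \<Rightarrow> 'a::ab_group_add \<Rightarrow> 'a) \<Rightarrow> ('a \<Rightarrow> real) \<Rightarrow> bool" where
  "sublinear sc q \<longleftrightarrow> (\<forall>x y. q (x + y) \<le> q x + q y) \<and> (\<forall>t x. 0 \<le> t \<longrightarrow> q (sc (of_real t) x) = t * q x)"

lemma seminorm_nonneg:
  assumes "vector_space sc" "seminorm sc p"
  shows "0 \<le> p x"
proof -
  interpret vector_space sc by fact
  have "p (sc 0 x) = 0" "p (sc (-1) x) = p x" "p (x + sc (-1) x) \<le> p x + p (sc (-1) x)"
    using assms(2) unfolding seminorm_def by (metis norm_zero mult_zero_left, metis norm_minus_cancel norm_one mult_1, blast)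
  then show ?thesis by simp
qed

locale sublinear_functional = vector_space sc
  for sc :: "'k::real_normed_field \<Rightarrow> 'a::ab_group_add \<Rightarrow> 'a" +
  fixes q :: "'a \<Rightarrow> real"
  assumes subl: "sublinear sc q"
begin

lemma sub_add: "q (x + y) \<le> q x + q y"
  and sub_scale: "0 \<le> t \<Longrightarrow> q (sc (of_real t) x) = t * q x"
  using subl by (auto simp: sublinear_def)

lemma sub_0: "q 0 = 0"
  using sub_scale[of 0 0] by simp

lemma sub_minus: "- q (- x) \<le> q x"
  using sub_add[of x "- x"] sub_0 by simp

text \<open>This is the largest sublinear functional below q with value at most -q y at -y, since
  any such r satisfies r x \<le> r (x + t y) + t r (-y). A sublinear functional equal to all its
  lowerings is additive.\<close>

definition lower :: "'a \<Rightarrow> 'a \<Rightarrow> real" where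
  "lower y x = (INF t\<in>{0..}. q (x + sc (of_real t) y) - t * q y)"

lemma bdd_below_lower: "bdd_below ((\<lambda>t. q (x + sc (of_real t) y) - t * q y) ` {0..})"
proof (rule bdd_belowI2)
  fix t :: real assume "t \<in> {0..}"
  then have "t * q y = q (sc (of_real t) y)" by (simp add: sub_scale)
  also have "\<dots> \<le> q (x + sc (of_real t) y) + q (- x)"
    using sub_add[of "x + sc (of_real t) y" "- x"] by simp
  finally show "- q (- x) \<le> q (x + sc (of_real t) y) - t * q y" by simp
qed

lemma lower_le: "0 \<le> t \<Longrightarrow> lower y x \<le> q (x + sc (of_real t) y) - t * q y"
  unfolding lower_def by (rule cINF_lower[OF bdd_below_lower]) simp

lemma lower_greatest: "(\<And>t. 0 \<le> t \<Longrightarrow> c \<le> q (x + sc (of_real t) y) - t * q y) \<Longrightarrow> c \<le> lower y x"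
  unfolding lower_def by (rule cINF_greatest) auto

lemma lower_le_self: "lower y x \<le> q x"
  using lower_le[of 0 y x] by simp

lemma lower_minus: "lower y (- y) \<le> - q y"
  using lower_le[of 1 y "- y"] sub_0 by simp

lemma lower_scale_le:
  assumes "0 < s"
  shows "s * lower y x \<le> lower y (sc (of_real s) x)"
proof (rule lower_greatest)
  fix t :: real assume t: "0 \<le> t"
  have "lower y x \<le> q (x + sc (of_real (t / s)) y) - t / s * q y"
    using t assms by (intro lower_le) auto
  then have "s * lower y x \<le> s * (q (x + sc (of_real (t / s)) y) - t / s * q y)"
    using assms by simp
  also have "\<dots> = s * q (x + sc (of_real (t / s)) y) - t * q y"
    using assms by (simp add: right_diff_distrib)
  also have "s * q (x + sc (of_real (t / s)) y) = q (sc (of_real s) (x + sc (of_real (t / s)) y))"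
    using assms by (simp only: sub_scale less_imp_le)
  also have "sc (of_real s) (x + sc (of_real (t / s)) y) = sc (of_real s) x + sc (of_real t) y"
    using assms by (simp add: scale_right_distrib)
  finally show "s * lower y x \<le> q (sc (of_real s) x + sc (of_real t) y) - t * q y" .
qed

lemma sublinear_lower: "sublinear sc (lower y)"
  unfolding sublinear_def
proof (intro conjI allI impI)
  fix x z
  have "lower y (x + z) - (q (z + sc (of_real s) y) - s * q y) \<le> lower y x" if "0 \<le> s" for s
  proof (rule lower_greatest)
    fix t :: real assume "0 \<le> t"
    have "lower y (x + z) \<le> q ((x + z) + sc (of_real (t + s)) y) - (t + s) * q y"
      using \<open>0 \<le> t\<close> \<open>0 \<le> s\<close> by (intro lower_le) auto
    also have "(x + z) + sc (of_real (t + s)) y = (x + sc (of_real t) y) + (z + sc (of_real s) y)"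
      by (simp add: scale_left_distrib algebra_simps)
    finally show "lower y (x + z) - (q (z + sc (of_real s) y) - s * q y)
        \<le> q (x + sc (of_real t) y) - t * q y"
      using sub_add[of "x + sc (of_real t) y" "z + sc (of_real s) y"] by (simp add: algebra_simps)
  qed
  then have "lower y (x + z) - lower y x \<le> lower y z"
    by (intro lower_greatest) (simp add: algebra_simps)
  then show "lower y (x + z) \<le> lower y x + lower y z" by simp
next
  fix t :: real and x assume t: "0 \<le> t"
  show "lower y (sc (of_real t) x) = t * lower y x"
  proof (cases "t = 0")
    case True
    have "lower y 0 = 0"
      using lower_le_self[of y 0] sub_0 by (intro antisym lower_greatest) (auto simp: sub_scale)
    with True show ?thesis by simp
  next
    case False
    with t have "0 < t" by simp
    then have "lower y (sc (of_real t) x) \<le> t * lower y x"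
      using lower_scale_le[of "1 / t" y "sc (of_real t) x"] by (simp add: field_simps)
    with lower_scale_le[OF \<open>0 < t\<close>] show ?thesis by (simp add: antisym)
  qed
qed

end

text \<open>Zorn's lemma for the reversed pointwise order, hence the flipped \<open>P\<close>. Every
  sublinear f \<le> p satisfies -p (-x) \<le> f x, so the infimum of a nonempty chain is
  finite.\<close>

lemma sublinear_minimal:
  fixes sc :: "'k::real_normed_field \<Rightarrow> 'a::ab_group_add \<Rightarrow> 'a"
  assumes "vector_space sc" "sublinear sc p"
  obtains q where "sublinear sc q" "\<And>x. q x \<le> p x"
    "\<And>r. sublinear sc r \<Longrightarrow> (\<And>x. r x \<le> q x) \<Longrightarrow> r = q"
proof -
  interpret vector_space sc by fact
  define F where "F = {q. sublinear sc q \<and> q \<le> p}"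
  define P :: "('a \<Rightarrow> real) \<Rightarrow> ('a \<Rightarrow> real) \<Rightarrow> bool" where "P = (\<lambda>f g. g \<le> f)"
  have "\<exists>m\<in>F. \<forall>a\<in>F. P m a \<longrightarrow> a = m"
  proof (rule predicate_Zorn)
    show "partial_order_on F (relation_of P F)"
      by (rule partial_order_on_relation_ofI) (auto simp: P_def)
  next
    fix C assume C: "C \<in> Chains (relation_of P F)"
    then have CF: "C \<subseteq> F" and chain: "\<And>f g. f \<in> C \<Longrightarrow> g \<in> C \<Longrightarrow> f \<le> g \<or> g \<le> f"
      by (auto simp: Chains_def relation_of_def P_def)
    show "\<exists>u\<in>F. \<forall>a\<in>C. P a u"
    proof (cases "C = {}")
      case True
      with assms show ?thesis by (auto simp: F_def)
    next
      case False
      define u where "u x = (INF f\<in>C. f x)" for x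
      have subl: "sublinear_functional sc f" "f \<le> p" if "f \<in> C" for f
        using that CF assms(1) by (auto simp: F_def sublinear_functional_def sublinear_functional_axioms_def)
      have bdd: "bdd_below ((\<lambda>f. f x) ` C)" for x
      proof (rule bdd_belowI2)
        fix f assume "f \<in> C"
        then show "- p (- x) \<le> f x"
          using sublinear_functional.sub_minus[OF subl(1), of f x] subl(2)[of f]
          by (smt (verit) le_funD)
      qed
      have le: "u x \<le> f x" if "f \<in> C" for f x
        unfolding u_def by (rule cINF_lower[OF bdd that])
      have greatest: "c \<le> u x" if "\<And>f. f \<in> C \<Longrightarrow> c \<le> f x" for c x
        unfolding u_def by (rule cINF_greatest[OF False that])
      have add: "u (x + y) \<le> u x + u y" for x y
      proof -
        have "u (x + y) - g y \<le> f x" if "f \<in> C" "g \<in> C" for f g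
        proof -
          \<comment> \<open>Near-optimal functionals f at x and g at y may differ; being comparable,
            they can be replaced by the smaller one at both points.\<close>
          have "\<exists>h\<in>C. h \<le> f \<and> h \<le> g" using chain[OF that] that by blast
          then obtain h where h: "h \<in> C" "h \<le> f" "h \<le> g" by blast
          have "u (x + y) \<le> h x + h y"
            using le[OF h(1), of "x + y"] sublinear_functional.sub_add[OF subl(1)[OF h(1)], of x y] by linarith
          with h(2,3) show ?thesis by (smt (verit) le_funD)
        qed
        then have "u (x + y) - g y \<le> u x" if "g \<in> C" for g
          using that greatest by blast
        then have "u (x + y) - u x \<le> u y"
          by (intro greatest) (simp add: algebra_simps)
        then show ?thesis by simp
      qed
      have scale: "u (sc (of_real t) x) = t * u x" if "0 \<le> t" for t x
      proof (cases "t = 0")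
        case True
        have "u 0 = 0"
          using False le[of _ 0] greatest[of 0 0] sublinear_functional.sub_0[OF subl(1)]
          by (metis ex_in_conv order_antisym order_refl)
        with True show ?thesis by simp
      next
        case t: False
        with that have "0 < t" by simp
        have le_scale: "s * u x \<le> u (sc (of_real s) x)" if "0 < s" for s x
        proof (rule greatest)
          fix f assume f: "f \<in> C"
          then have "f (sc (of_real s) x) = s * f x"
            using that by (intro sublinear_functional.sub_scale[OF subl(1)]) simp_all
          then show "s * u x \<le> f (sc (of_real s) x)" using le[OF f] that by simp
        qed
        have "u (sc (of_real t) x) \<le> t * u x"
          using le_scale[of "1 / t" "sc (of_real t) x"] \<open>0 < t\<close> by (simp add: field_simps)
        with le_scale[OF \<open>0 < t\<close>] show ?thesis by (simp add: antisym)
      qed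
      obtain f where "f \<in> C" using False by blast
      then have "u \<le> p" using le subl(2) by (meson le_funI le_funD order_trans)
      then have "u \<in> F" using add scale by (simp add: F_def sublinear_def)
      with le show ?thesis by (auto simp: P_def le_fun_def)
    qed
  qed
  then obtain q where q: "sublinear sc q" "q \<le> p"
    and min: "\<And>r. sublinear sc r \<Longrightarrow> r \<le> p \<Longrightarrow> r \<le> q \<Longrightarrow> r = q"
    by (auto simp: F_def P_def)
  show thesis
  proof (rule that[OF q(1)])
    show "q x \<le> p x" for x using q(2) by (rule le_funD)
    show "r = q" if "sublinear sc r" "\<And>x. r x \<le> q x" for r
      using min that q(2) by (meson le_funI order_trans)
  qed
qed

text \<open>A minimal f equals each of its lowerings, and t = 1 in their definition gives f x + f z
  \<le> f (x + z). Minimising below \<open>p.lower y\<close> rather than below p forces f (-y) \<le>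
  -p y, hence f y = p y.\<close>

lemma real_hahn_banach:
  fixes sc :: "'k::real_normed_field \<Rightarrow> 'a::ab_group_add \<Rightarrow> 'a"
  assumes "vector_space sc" "sublinear sc p"
  obtains f where "\<And>x y. f (x + y) = f x + f y" "\<And>t x. f (sc (of_real t) x) = t * f x"
    "\<And>x. f x \<le> p x" "f y = p y"
proof -
  interpret p: sublinear_functional sc p
    using assms by (simp add: sublinear_functional_def sublinear_functional_axioms_def)
  obtain f where f: "sublinear sc f" "\<And>x. f x \<le> p.lower y x"
    and min: "\<And>r. sublinear sc r \<Longrightarrow> (\<And>x. r x \<le> f x) \<Longrightarrow> r = f"
    using sublinear_minimal[OF assms(1) p.sublinear_lower[of y]] by blast
  interpret f: sublinear_functional sc f
    using assms f by (simp add: sublinear_functional_def sublinear_functional_axioms_def)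
  have "f x + f z \<le> f (x + z)" for x z
    using f.lower_le[of 1 z x] min[OF f.sublinear_lower f.lower_le_self, of z] by simp
  then have add: "f (x + z) = f x + f z" for x z
    using f.sub_add by (simp add: antisym)
  have minus: "f (- x) = - f x" for x
    using add[of x "- x"] f.sub_0 by simp
  have "f (sc (of_real t) x) = t * f x" for t x
  proof (cases "0 \<le> t")
    case False
    then have "f (sc (of_real (- t)) (- x)) = - t * f (- x)" by (intro f.sub_scale) simp
    then show ?thesis by (simp add: minus)
  qed (rule f.sub_scale)
  moreover have le: "f x \<le> p x" for x
    using f(2) p.lower_le_self order_trans by blast
  moreover have "f y = p y"
    using f(2)[of "- y"] p.lower_minus[of y] minus[of y] le[of y] by simp
  ultimately show thesis using that add by blast
qed

text \<open>A real functional g \<le> p with g y = p y is made linear over the scalar field; if that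
  field contains a root i of -1, this is the usual complexification g x - i g (i x). Its value at y
  is nonzero, so dividing by it normalises f.\<close>

lemma functional_bounded_by_seminorm:
  fixes sc :: "'k::real_normed_field \<Rightarrow> 'a::ab_group_add \<Rightarrow> 'a"
  assumes "vector_space sc" "seminorm sc p" "p y \<noteq> 0"
  obtains f :: "'a \<Rightarrow> 'k" and M where "0 \<le> M" "\<And>x z. f (x + z) = f x + f z" "\<And>c x. f (sc c x) = c * f x"
    "\<And>x. norm (f x) \<le> M * p x" "f y = 1"
proof -
  interpret vector_space sc by fact
  have p0: "0 \<le> p x" for x using assms(1,2) by (rule seminorm_nonneg)
  have pscale: "p (sc c x) = norm c * p x" for c x using assms(2) by (simp add: seminorm_def)
  have pminus: "p (- x) = p x" for x using pscale[of "-1" x] by simp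
  have "sublinear sc p" using assms(2) by (auto simp: seminorm_def sublinear_def)
  then obtain g where gadd: "\<And>x y. g (x + y) = g x + g y" and gscale: "\<And>t x. g (sc (of_real t) x) = t * g x"
    and gle: "\<And>x. g x \<le> p x" and gy: "g y = p y"
    using real_hahn_banach[OF assms(1)] by metis
  have gminus: "g (- x) = - g x" for x using gscale[of "-1" x] by simp
  have gabs: "\<bar>g x\<bar> \<le> p x" for x using gle[of x] gle[of "- x"] by (simp add: gminus pminus)
  have "\<exists>h::'a \<Rightarrow> 'k. (\<forall>x z. h (x + z) = h x + h z) \<and> (\<forall>c x. h (sc c x) = c * h x) \<and>
      (\<forall>x. norm (h x) \<le> 2 * p x) \<and> h y \<noteq> 0"
  proof (cases rule: real_normed_field_cases[where ?'k = 'k])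
    case real
    have "of_real (g (sc c x)) = c * of_real (g x)" for c :: 'k and x
      using real[of c] by (auto elim!: Reals_cases simp: gscale)
    moreover have "norm (of_real (g x) :: 'k) \<le> 2 * p x" for x
      using gabs[of x] p0[of x] by simp
    ultimately show ?thesis using gy assms(3)
      by (intro exI[of _ "\<lambda>x. of_real (g x)"]) (simp add: gadd)
  next
    case (complex i)
    define h where "h x = of_real (g x) - i * of_real (g (sc i x))" for x
    have "norm i ^ 2 = 1" using complex(1) by (metis norm_minus_cancel norm_one norm_power)
    then have i1: "norm i = 1" by (simp add: power2_eq_1_iff) (smt (verit) norm_ge_zero)
    have ii: "i * i = -1" using complex(1) by (simp add: power2_eq_square)
    have add: "h (x + z) = h x + h z" for x z
      by (simp add: h_def scale_right_distrib gadd algebra_simps)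
    have r: "h (sc (of_real t) x) = of_real t * h x" for t x
      using gscale[of t "sc i x"] by (simp add: h_def gscale mult.commute algebra_simps)
    have im: "h (sc i x) = i * h x" for x
    proof -
      have "i * h x = i * of_real (g x) - (i * i) * of_real (g (sc i x))"
        by (simp add: h_def algebra_simps)
      then show ?thesis by (simp add: h_def ii gminus)
    qed
    have scale: "h (sc c x) = c * h x" for c x
    proof -
      obtain s t where c: "c = of_real s + i * of_real t" using complex(2) by blast
      have "sc c x = sc (of_real s) x + sc i (sc (of_real t) x)"
        by (simp add: c scale_left_distrib)
      then have "h (sc c x) = of_real s * h x + i * (of_real t * h x)" by (simp only: add r im)
      then show ?thesis by (simp add: c algebra_simps)
    qed
    have "norm (h x) \<le> 2 * p x" for x
    proof -
      have "norm (h x) \<le> \<bar>g x\<bar> + \<bar>g (sc i x)\<bar>"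
        unfolding h_def by (rule order_trans[OF norm_triangle_ineq4]) (simp add: norm_mult i1)
      with gabs[of x] gabs[of "sc i x"] show ?thesis by (simp add: pscale i1)
    qed
    \<comment> \<open>No real-part map is at hand for the abstract i. Squaring replaces it: h y = 0
      gives (g y)^2 = -(g (i y))^2 in the reals.\<close>
    moreover have "h y \<noteq> 0"
    proof
      assume "h y = 0"
      then have "of_real (g y) = i * of_real (g (sc i y))" by (simp add: h_def)
      then have "of_real ((g y)\<^sup>2) = (i * of_real (g (sc i y)))\<^sup>2" by simp
      also have "\<dots> = of_real (- ((g (sc i y))\<^sup>2))" by (simp add: power_mult_distrib complex(1))
      finally have "(g y)\<^sup>2 = - ((g (sc i y))\<^sup>2)" by (simp only: of_real_eq_iff)
      then have "(g y)\<^sup>2 \<le> 0" by simp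
      with gy assms(3) show False by simp
    qed
    ultimately show ?thesis using add scale by blast
  qed
  then obtain h :: "'a \<Rightarrow> 'k" where h: "\<And>x z. h (x + z) = h x + h z" "\<And>c x. h (sc c x) = c * h x"
      "\<And>x. norm (h x) \<le> 2 * p x" "h y \<noteq> 0" by blast
  show thesis
  proof (rule that[of "2 / norm (h y)" "\<lambda>x. h x / h y"])
    show "norm (h x / h y) \<le> 2 / norm (h y) * p x" for x
      using h(3)[of x] by (simp add: norm_divide divide_right_mono)
  qed (use h in \<open>auto simp: add_divide_distrib\<close>)
qed

section \<open>Functionals separating a vector from a finite p-independent set\<close>

lemma p_independent_subset: "p_independent sc p A \<Longrightarrow> B \<subseteq> A \<Longrightarrow> p_independent sc p B"
  unfolding p_independent_def by (meson subset_trans)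

text \<open>Induction on the finite set: one vector a is removed by a functional f with f a = 1, after
  passing from p to the seminorm x \<mapsto> p (x - f x a), which vanishes at a. This avoids any
  compactness argument in the span of the set.\<close>

lemma functional_vanishing_on:
  fixes sc :: "'k::real_normed_field \<Rightarrow> 'a::ab_group_add \<Rightarrow> 'a"
  assumes "vector_space sc" "finite S" "seminorm sc p" "p_independent sc p (insert y S)" "y \<notin> S"
  obtains f :: "'a \<Rightarrow> 'k" and M where "0 \<le> M" "\<And>x z. f (x + z) = f x + f z" "\<And>c x. f (sc c x) = c * f x"
    "\<And>x. norm (f x) \<le> M * p x" "\<And>a. a \<in> S \<Longrightarrow> f a = 0" "f y = 1"
proof -
  interpret vector_space sc by fact
  have single: "p a \<noteq> 0" if "p_independent sc p A" "a \<in> A" for p and a :: 'a and A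
    using that(1)[unfolded p_independent_def, rule_format, of "{a}" "\<lambda>_. 1"] that(2) by simp
  have "\<exists>(f :: 'a \<Rightarrow> 'k) M. 0 \<le> M \<and> (\<forall>x z. f (x + z) = f x + f z) \<and> (\<forall>c x. f (sc c x) = c * f x) \<and>
    (\<forall>x. norm (f x) \<le> M * p x) \<and> (\<forall>a\<in>S. f a = 0) \<and> f y = 1"
    using assms(2-)
  proof (induction S arbitrary: p)
    case empty
    show ?case
      by (rule functional_bounded_by_seminorm[OF assms(1) empty(1) single[OF empty(2)], of y]) auto
  next
    case (insert a S)
    obtain f :: "'a \<Rightarrow> 'k" and M where M: "0 \<le> M" and fadd: "\<And>x z. f (x + z) = f x + f z"
      and fscale: "\<And>c x. f (sc c x) = c * f x" and fle: "\<And>x. norm (f x) \<le> M * p x" and fa: "f a = 1"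
      by (rule functional_bounded_by_seminorm[OF assms(1) insert.prems(1) single[OF insert.prems(2)], of a]) auto
    have padd: "p (x + z) \<le> p x + p z" and pscale: "p (sc c x) = norm c * p x" for x z c
      using insert.prems(1) by (auto simp: seminorm_def)
    define p' where "p' x = p (x + sc (- f x) a)" for x
    define L where "L = 1 + M * p a"
    have L: "0 \<le> L" using M seminorm_nonneg[OF assms(1) insert.prems(1)] by (simp add: L_def)
    have p'_le: "p' x \<le> L * p x" for x
    proof -
      have "p' x \<le> p x + norm (f x) * p a" using padd[of x "sc (- f x) a"] unfolding p'_def pscale by simp
      also have "norm (f x) * p a \<le> M * p x * p a"
        using fle seminorm_nonneg[OF assms(1) insert.prems(1)] by (simp add: mult_right_mono)
      finally show ?thesis by (simp add: L_def algebra_simps)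
    qed
    have p': "seminorm sc p'"
      unfolding seminorm_def
    proof (intro conjI allI)
      fix x z
      have "x + z + sc (- f (x + z)) a = (x + sc (- f x) a) + (z + sc (- f z) a)"
        by (simp add: fadd scale_left_distrib scale_left_diff_distrib)
      then show "p' (x + z) \<le> p' x + p' z" by (simp only: p'_def padd)
    next
      fix c x
      have "sc c x + sc (- f (sc c x)) a = sc c (x + sc (- f x) a)"
        by (simp add: fscale scale_right_diff_distrib)
      then show "p' (sc c x) = norm c * p' x" by (simp only: p'_def pscale)
    qed
    have indep: "p_independent sc p' (insert y S)"
      unfolding p_independent_def
    proof (intro allI impI)
      fix T z assume T: "finite T \<and> T \<noteq> {} \<and> T \<subseteq> insert y S \<and> (\<forall>a\<in>T. z a \<noteq> (0 :: 'k))"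
      define x where "x = (\<Sum>t\<in>T. sc (z t) t)"
      have aT: "a \<notin> T" using T insert.hyps insert.prems by auto
      have ind: "p (\<Sum>t\<in>T'. sc (w t) t) \<noteq> 0"
        if "finite T'" "T' \<noteq> {}" "T' \<subseteq> insert y (insert a S)" "\<forall>t\<in>T'. w t \<noteq> 0" for T' w
        using insert.prems(2) that unfolding p_independent_def by blast
      show "p' (\<Sum>t\<in>T. sc (z t) t) \<noteq> 0"
      \<comment> \<open>The value of p' at x is p of the combination extended by a with coefficient
        -f x. Independence speaks of nonzero coefficients, so a joins the index set exactly when f x
        \<noteq> 0.\<close>
      proof (cases "f x = 0")
        case True
        then show ?thesis using ind[of T z] T by (auto simp: p'_def x_def)
      next
        case False
        define w where "w = z(a := - f x)"
        have "(\<Sum>t\<in>insert a T. sc (w t) t) = x + sc (- f x) a"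
          using T aT by (simp add: w_def x_def add.commute) (intro sum.cong, auto)
        moreover have "p (\<Sum>t\<in>insert a T. sc (w t) t) \<noteq> 0"
          using T False by (intro ind) (auto simp: w_def)
        ultimately show ?thesis by (simp add: p'_def x_def)
      qed
    qed
    obtain g :: "'a \<Rightarrow> 'k" and N where g: "0 \<le> N" "\<And>x z. g (x + z) = g x + g z"
      "\<And>c x. g (sc c x) = c * g x" "\<And>x. norm (g x) \<le> N * p' x" "\<And>a. a \<in> S \<Longrightarrow> g a = 0" "g y = 1"
      using insert.IH[OF p' indep] insert.prems(3) by blast
    \<comment> \<open>The bound by p' alone forces g a = 0, and p' \<le> L p turns it into a bound
      by p.\<close>
    have "p' a = 0" using pscale[of 0 0] by (simp add: p'_def fa)
    then have "g a = 0" using g(4)[of a] by simp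
    moreover have "norm (g x) \<le> N * L * p x" for x
      using g(4)[of x] mult_left_mono[OF p'_le g(1), of x] by (simp add: mult.assoc)
    ultimately show ?case using g L by (intro exI[of _ g] exI[of _ "N * L"]) auto
  qed
  then show thesis using that by blast
qed

subsection \<open>Perturbations of the identity\<close>

text \<open>J maps a combination in ker p to one in ker p with the same coefficients; injectivity
  keeps the images distinct, so no coefficients merge. It serves the step in which a prescribed
  target is pulled back.\<close>

lemma p_independent_linear_preimage:
  assumes "Vector_Spaces.linear sc sc J" "inj_on J S" "\<And>x. p x = 0 \<Longrightarrow> p (J x) = 0"
    and "p_independent sc p (J ` S)"
  shows "p_independent sc p S"
  unfolding p_independent_def
proof (intro allI impI notI)
  interpret J: Vector_Spaces.linear sc sc J by fact
  fix T z assume T: "finite T \<and> T \<noteq> {} \<and> T \<subseteq> S \<and> (\<forall>a\<in>T. z a \<noteq> 0)"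
    and p0: "p (\<Sum>a\<in>T. sc (z a) a) = 0"
  have inj: "inj_on J T" using assms(2) T inj_on_subset by blast
  define w where "w = (\<lambda>b. z (inv_into T J b))"
  have "J (\<Sum>a\<in>T. sc (z a) a) = (\<Sum>a\<in>T. sc (w (J a)) (J a))"
    by (simp add: J.sum J.scale w_def inv_into_f_f[OF inj] cong: sum.cong)
  also have "\<dots> = (\<Sum>b\<in>J ` T. sc (w b) b)" by (simp add: sum.reindex[OF inj])
  finally have "p (\<Sum>b\<in>J ` T. sc (w b) b) = 0" using assms(3)[OF p0] by simp
  moreover have "\<forall>b\<in>J ` T. w b \<noteq> 0" using T by (auto simp: w_def inv_into_f_f[OF inj])
  ultimately show False
    using assms(4)[unfolded p_independent_def, rule_format, of "J ` T" w] T by auto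
qed

text \<open>\<open>V\<close> and \<open>q\<close> stand for X_D and its norm; \<open>C\<close>
  bounds the inclusion of \<open>V\<close> into (X, p). The laws for \<open>q\<close> are confined
  to \<open>V\<close>, because outside the span the Minkowski functional is an infimum of the empty
  set.\<close>

locale normed_subspace = vector_space sc
  for sc :: "'k::real_normed_field \<Rightarrow> 'a::ab_group_add \<Rightarrow> 'a" +
  fixes p q :: "'a \<Rightarrow> real" and V :: "'a set" and C :: real
  assumes seminorm_p: "seminorm sc p"
    and subspace_V: "subspace V"
    and q_add: "x \<in> V \<Longrightarrow> y \<in> V \<Longrightarrow> q (x + y) \<le> q x + q y"
    and q_scale: "x \<in> V \<Longrightarrow> q (sc c x) = norm c * q x"
    and q_eq_0D: "x \<in> V \<Longrightarrow> q x = 0 \<Longrightarrow> x = 0"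
    and p_le_q: "x \<in> V \<Longrightarrow> p x \<le> C * q x"
    and C_pos: "0 < C"
    and complete_V: "(\<And>n. s n \<in> V) \<Longrightarrow> (\<And>e. 0 < e \<Longrightarrow> \<exists>N. \<forall>m\<ge>N. \<forall>n\<ge>N. q (s m - s n) < e) \<Longrightarrow>
      \<exists>x\<in>V. (\<lambda>n::nat. q (s n - x)) \<longlonglongrightarrow> 0"
begin

section \<open>Arithmetic and limits in the complete normed space V\<close>

lemmas V_add = subspace_add[OF subspace_V]
  and V_diff = subspace_diff[OF subspace_V]
  and V_scale = subspace_scale[OF subspace_V]
  and V_neg = subspace_neg[OF subspace_V]
  and V_0 = subspace_0[OF subspace_V]

lemma p_nonneg: "0 \<le> p x"
  using vector_space_axioms seminorm_p by (rule seminorm_nonneg)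

lemma p_add: "p (x + y) \<le> p x + p y"
  using seminorm_p by (simp add: seminorm_def)

lemma q_0: "q 0 = 0"
  using q_scale[of 0 0] V_0 by simp

lemma q_minus: "x \<in> V \<Longrightarrow> q (- x) = q x"
  using q_scale[of x "-1"] by simp

lemma q_minus_commute: "x \<in> V \<Longrightarrow> y \<in> V \<Longrightarrow> q (x - y) = q (y - x)"
  using q_minus[of "x - y"] V_diff by simp

lemma q_nonneg: "x \<in> V \<Longrightarrow> 0 \<le> q x"
  using q_add[of x "- x"] q_minus[of x] V_neg[of x] q_0 by simp

lemma q_triangle: "x \<in> V \<Longrightarrow> y \<in> V \<Longrightarrow> z \<in> V \<Longrightarrow> q (x - z) \<le> q (x - y) + q (y - z)"
  using q_add[of "x - y" "y - z"] V_diff by simp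

lemma q_limit_unique:
  assumes "\<And>n. s n \<in> V" "x \<in> V" "y \<in> V" "(\<lambda>n::nat. q (s n - x)) \<longlonglongrightarrow> 0" "(\<lambda>n. q (s n - y)) \<longlonglongrightarrow> 0"
  shows "x = y"
proof -
  have "(\<lambda>n. q (s n - x) + q (s n - y)) \<longlonglongrightarrow> 0 + 0" using assms by (intro tendsto_add)
  moreover have "q (x - y) \<le> q (s n - x) + q (s n - y)" for n
    using q_triangle[of x "s n" y] q_minus_commute[of x "s n"] assms by simp
  ultimately have "q (x - y) \<le> 0 + 0" by (intro LIMSEQ_le_const) auto
  then have "q (x - y) = 0" using q_nonneg[OF V_diff[OF assms(2,3)]] by simp
  then show ?thesis using q_eq_0D[of "x - y"] V_diff assms by simp
qed

lemma q_limit_exists: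
  assumes V: "\<And>n. s n \<in> V" and le: "\<And>n. q (s (Suc n) - s n) \<le> d n" and "summable d"
  shows "\<exists>x\<in>V. (\<lambda>n::nat. q (s n - x)) \<longlonglongrightarrow> 0"
proof (rule complete_V[OF V])
  fix e :: real assume "0 < e"
  have sum: "q (s n - s m) \<le> sum d {m..<n}" if "m \<le> n" for m n
    using that
  proof (induction n rule: dec_induct)
    case base
    then show ?case by (simp add: q_0)
  next
    case (step n)
    have "q (s (Suc n) - s m) \<le> q (s (Suc n) - s n) + q (s n - s m)"
      by (rule q_triangle) (simp_all add: V)
    also have "\<dots> \<le> d n + sum d {m..<n}" using le[of n] step by simp
    finally show ?case using step by (simp add: sum.atLeastLessThan_Suc add.commute)
  qed
  obtain N where N: "\<And>m n. N \<le> m \<Longrightarrow> norm (sum d {m..<n}) < e"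
    using \<open>summable d\<close> \<open>0 < e\<close> unfolding summable_Cauchy by blast
  have "q (s n - s m) < e" if "N \<le> m" "m \<le> n" for m n
    using sum[OF that(2)] N[OF that(1), of n] by simp
  then have "q (s m - s n) < e" if "N \<le> m" "N \<le> n" for m n
    using that q_minus_commute V by (metis nat_le_linear)
  then show "\<exists>N. \<forall>m\<ge>N. \<forall>n\<ge>N. q (s m - s n) < e" by blast
qed

text \<open>These are the operators from (X, p) to (V, q) of norm at most c. The class is closed
  under pointwise limits and, with another c, under passing from x + T x to its inverse.\<close>

definition small :: "real \<Rightarrow> ('a \<Rightarrow> 'a) \<Rightarrow> bool" where
  "small c T \<longleftrightarrow> Vector_Spaces.linear sc sc T \<and> (\<forall>x. T x \<in> V \<and> q (T x) \<le> c * p x)"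

lemma small_V: "small c T \<Longrightarrow> T x \<in> V"
  and small_le: "small c T \<Longrightarrow> q (T x) \<le> c * p x"
  by (auto simp: small_def)

lemma small_add: "small c T \<Longrightarrow> T (x + y) = T x + T y"
  and small_scale: "small c T \<Longrightarrow> T (sc a x) = sc a (T x)"
  by (auto simp: small_def Vector_Spaces.linear_iff)

lemma small_diff: "small c T \<Longrightarrow> T (x - y) = T x - T y"
  using small_add[of c T "x - y" y] by simp

lemma small_mono:
  assumes "small c T" "c \<le> d" shows "small d T"
proof -
  have "q (T x) \<le> d * p x" for x
    using small_le[OF assms(1), of x] mult_right_mono[OF assms(2) p_nonneg[of x]] by simp
  then show ?thesis using assms(1) by (simp add: small_def)
qed

lemma linearI: "(\<And>x y. T (x + y) = T x + T y) \<Longrightarrow> (\<And>c x. T (sc c x) = sc c (T x)) \<Longrightarrow> Vector_Spaces.linear sc sc T"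
  using vector_space_axioms by (simp add: Vector_Spaces.linear_iff)

lemma small_eq_0: "small c T \<Longrightarrow> p x = 0 \<Longrightarrow> T x = 0"
  using small_le[of c T x] q_nonneg[of "T x"] small_V[of c T x] q_eq_0D[of "T x"] by simp

lemma linear_small_perturbation:
  assumes T: "small c T" shows "Vector_Spaces.linear sc sc (\<lambda>x. x + T x)"
  by (rule linearI) (simp_all add: small_add[OF T] small_scale[OF T] scale_right_distrib algebra_simps)

lemma small_q_le:
  assumes "small c T" "0 \<le> c" "x \<in> V"
  shows "q (T x) \<le> c * C * q x"
proof -
  have "c * p x \<le> c * (C * q x)" using assms p_le_q by (simp add: mult_left_mono)
  then show ?thesis using small_le[OF assms(1), of x] by simp
qed

text \<open>The equation y = x + T x is solved for the correction v = x - y alone. It satisfies v =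
  -T (y + v), hence lies in V, where the right side contracts by c * C.\<close>

lemma bij_small_perturbation:
  assumes T: "small c T" and c: "0 \<le> c" "c * C < 1"
  shows "bij (\<lambda>x. x + T x)"
proof (rule bijI)
  show "inj (\<lambda>x. x + T x)"
  proof (rule injI)
    fix x y assume "x + T x = y + T y"
    then have eq: "x - y = - T (x - y)" by (simp add: small_diff[OF T] algebra_simps)
    define u where "u = x - y"
    have u: "u = - T u" using eq by (simp add: u_def)
    \<comment> \<open>A vector with u = -T u lies in the range of T, so the contraction estimate on
      V applies to it.\<close>
    then have "u \<in> V" using V_neg small_V[OF T] by metis
    then have "q u \<le> c * C * q u" using small_q_le[OF T c(1)] q_minus[OF small_V[OF T]] u by metis
    then have "(1 - c * C) * q u \<le> 0" by (simp add: algebra_simps)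
    then have "q u \<le> 0" using c(2) by (simp add: mult_le_0_iff)
    then have "u = 0" using q_nonneg[OF \<open>u \<in> V\<close>] q_eq_0D[OF \<open>u \<in> V\<close>] by simp
    then show "x = y" by (simp add: u_def)
  qed
  show "surj (\<lambda>x. x + T x)"
    unfolding surj_def
  proof
    fix y
    define s where "s n = ((\<lambda>v. - T (y + v)) ^^ n) 0" for n
    have s0: "s 0 = 0" and sS: "s (Suc n) = - T (y + s n)" for n by (simp_all add: s_def)
    have sV: "s n \<in> V" for n by (cases n) (simp_all add: s0 sS V_0 V_neg small_V[OF T])
    have diff: "q (s (Suc n) - - T (y + v)) \<le> c * C * q (s n - v)" if "v \<in> V" for n v
    proof -
      have "s (Suc n) - - T (y + v) = - T (s n - v)"
        by (simp add: sS small_add[OF T] small_diff[OF T])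
      then show ?thesis using q_minus small_V[OF T] small_q_le[OF T c(1), of "s n - v"] V_diff sV that by simp
    qed
    have "q (s (Suc n) - s n) \<le> q (s 1) * (c * C) ^ n" for n
    proof (induction n)
      case (Suc n)
      have "q (s (Suc (Suc n)) - s (Suc n)) \<le> c * C * q (s (Suc n) - s n)"
        using diff[OF sV[of n], of "Suc n"] by (simp add: sS)
      also have "\<dots> \<le> c * C * (q (s 1) * (c * C) ^ n)" using Suc c C_pos by (intro mult_left_mono) auto
      finally show ?case by (simp add: mult_ac)
    qed (simp add: s0)
    moreover have "summable (\<lambda>n. q (s 1) * (c * C) ^ n)"
      using c C_pos by (intro summable_mult summable_geometric) simp
    ultimately obtain v where v: "v \<in> V" "(\<lambda>n. q (s n - v)) \<longlonglongrightarrow> 0"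
      using q_limit_exists[of s "\<lambda>n. q (s 1) * (c * C) ^ n"] sV by auto
    have "(\<lambda>n. q (s (Suc n) - - T (y + v))) \<longlonglongrightarrow> 0"
    proof (rule tendsto_sandwich[OF _ _ tendsto_const])
      show "(\<lambda>n. c * C * q (s n - v)) \<longlonglongrightarrow> 0" using tendsto_mult_right_zero[OF v(2)] .
      show "\<forall>\<^sub>F n in sequentially. 0 \<le> q (s (Suc n) - - T (y + v))"
        using V_diff[OF sV V_neg[OF small_V[OF T]]] by (simp add: q_nonneg)
      show "\<forall>\<^sub>F n in sequentially. q (s (Suc n) - - T (y + v)) \<le> c * C * q (s n - v)"
        using diff[OF v(1)] by simp
    qed
    then have "v = - T (y + v)"
      using v LIMSEQ_Suc[OF v(2)] sV V_neg small_V[OF T] by (intro q_limit_unique[of "\<lambda>n. s (Suc n)"]) auto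
    then have "y = (y + v) + T (y + v)" by (simp add: add.assoc eq_neg_iff_add_eq_0)
    then show "\<exists>x. y = x + T x" by blast
  qed
qed

text \<open>If y = x + T x, the inverse moves y by -T x, and p x \<le> p y + c * C * p x yields the
  constant. One continuity argument thus serves the map and its inverse.\<close>

lemma small_inverse_perturbation:
  assumes T: "small c T" and c: "0 \<le> c" "c * C < 1"
  shows "small (c / (1 - c * C)) (\<lambda>y. inv (\<lambda>x. x + T x) y - y)"
proof -
  define J where "J = (\<lambda>x. x + T x)"
  have bij: "bij J" unfolding J_def using assms by (rule bij_small_perturbation)
  have linJ: "Vector_Spaces.linear sc sc J" unfolding J_def by (rule linear_small_perturbation[OF T])
  have JI: "J (inv J y) = y" for y using bij by (simp add: bij_is_surj surj_f_inv_f)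
  have Jadd: "J (x + y) = J x + J y" and Jscale: "J (sc a x) = sc a (J x)" for x y a
    using linJ by (simp_all add: Vector_Spaces.linear_iff)
  have Ieq: "inv J y = x" if "J x = y" for x y using bij that by (auto simp: bij_is_inj)
  have eq: "inv J y - y = - T (inv J y)" for y using JI[of y] by (simp add: J_def algebra_simps)
  have "Vector_Spaces.linear sc sc (\<lambda>y. inv J y - y)"
  proof (rule linearI)
    show "inv J (x + y) - (x + y) = (inv J x - x) + (inv J y - y)" for x y
    proof -
      have "inv J (x + y) = inv J x + inv J y" by (rule Ieq) (simp add: Jadd JI)
      then show ?thesis by simp
    qed
    show "inv J (sc a x) - sc a x = sc a (inv J x - x)" for a x
    proof -
      have "inv J (sc a x) = sc a (inv J x)" by (rule Ieq) (simp add: Jscale JI)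
      then show ?thesis by (simp add: scale_right_diff_distrib)
    qed
  qed
  moreover have "q (inv J y - y) \<le> c / (1 - c * C) * p y" for y
  proof -
    define x where "x = inv J y"
    have y: "y = x + T x" using JI[of y] by (simp add: x_def J_def)
    have "p x \<le> p y + p (- T x)" using p_add[of y "- T x"] y by simp
    also have "p (- T x) \<le> C * q (T x)" using p_le_q[of "- T x"] V_neg q_minus small_V[OF T] by simp
    also have "\<dots> \<le> C * (c * p x)" using C_pos small_le[OF T] by simp
    finally have "(1 - c * C) * p x \<le> p y" by (simp add: algebra_simps)
    then have "p x \<le> p y / (1 - c * C)" using c(2) by (simp add: field_simps)
    then have "c * p x \<le> c * (p y / (1 - c * C))" using c(1) by (rule mult_left_mono)
    then show ?thesis
      using small_le[OF T, of x] q_minus[OF small_V[OF T], of x] unfolding eq x_def by simp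
  qed
  ultimately show ?thesis
    using V_neg small_V[OF T] unfolding small_def J_def[symmetric] by (simp add: eq)
qed

text \<open>For fixed x the increments d n * p x are summable, so the values converge in V.
  Uniqueness of q-limits carries linearity over, and the bound c, uniform in n, survives.\<close>

lemma small_limit:
  assumes T: "\<And>n. small c (T n)" and le: "\<And>n x. q (T (Suc n) x - T n x) \<le> d n * p x" and "summable d"
  obtains T' where "small c T'" "\<And>x. (\<lambda>n. q (T n x - T' x)) \<longlonglongrightarrow> 0"
proof -
  have "\<exists>y\<in>V. (\<lambda>n. q (T n x - y)) \<longlonglongrightarrow> 0" for x
    using small_V[OF T] le summable_mult2[OF \<open>summable d\<close>] by (intro q_limit_exists[where d = "\<lambda>n. d n * p x"]) auto
  then obtain T' where V: "\<And>x. T' x \<in> V" and lim: "\<And>x. (\<lambda>n. q (T n x - T' x)) \<longlonglongrightarrow> 0"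
    by metis
  have "small c T'"
    unfolding small_def
  proof (intro conjI allI)
    show "Vector_Spaces.linear sc sc T'"
    proof (rule linearI)
      fix x y
      show "T' (x + y) = T' x + T' y"
      proof (rule q_limit_unique[of "\<lambda>n. T n (x + y)"])
        show "(\<lambda>n. q (T n (x + y) - (T' x + T' y))) \<longlonglongrightarrow> 0"
        proof (rule tendsto_sandwich[OF _ _ tendsto_const])
          show "(\<lambda>n. q (T n x - T' x) + q (T n y - T' y)) \<longlonglongrightarrow> 0"
            using tendsto_add[OF lim[of x] lim[of y]] by simp
          show "\<forall>\<^sub>F n in sequentially. 0 \<le> q (T n (x + y) - (T' x + T' y))"
            by (simp add: q_nonneg V_diff V_add V small_V[OF T])
          have "q (T n (x + y) - (T' x + T' y)) \<le> q (T n x - T' x) + q (T n y - T' y)" for n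
            using q_add[of "T n x - T' x" "T n y - T' y"] V_diff V small_V[OF T]
            by (simp add: small_add[OF T] algebra_simps)
          then show "\<forall>\<^sub>F n in sequentially. q (T n (x + y) - (T' x + T' y)) \<le> q (T n x - T' x) + q (T n y - T' y)"
            by simp
        qed
      qed (simp_all add: small_V[OF T] V V_add lim)
    next
      fix a x
      show "T' (sc a x) = sc a (T' x)"
      proof (rule q_limit_unique[of "\<lambda>n. T n (sc a x)"])
        have "q (T n (sc a x) - sc a (T' x)) = norm a * q (T n x - T' x)" for n
          using q_scale[of "T n x - T' x" a] V_diff V small_V[OF T]
          by (simp add: small_scale[OF T] scale_right_diff_distrib)
        then show "(\<lambda>n. q (T n (sc a x) - sc a (T' x))) \<longlonglongrightarrow> 0"
          using tendsto_mult_right_zero[OF lim[of x]] by simp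
      qed (simp_all add: small_V[OF T] V V_scale lim)
    qed
    fix x
    show "T' x \<in> V" by (rule V)
    have "(\<lambda>n. c * p x + q (T n x - T' x)) \<longlonglongrightarrow> c * p x + 0"
      by (intro tendsto_intros lim)
    moreover have "q (T' x) \<le> c * p x + q (T n x - T' x)" for n
      using q_triangle[of "T' x" "T n x" 0] q_minus_commute[of "T' x" "T n x"] V V_0 small_V[OF T] small_le[OF T, of n x]
      by simp
    ultimately have "q (T' x) \<le> c * p x + 0" by (intro LIMSEQ_le_const) auto
    then show "q (T' x) \<le> c * p x" by simp
  qed
  with lim that show thesis by blast
qed

text \<open>The correction is of rank one: T' = T + f(\<cdot>)/f(a) (b - a - T a), where f vanishes on S and f y = 1.\<close>

lemma small_adjust:
  assumes T: "small c T" "0 \<le> c" "c * C \<le> 1" and S: "finite S" "y \<notin> S" "p_independent sc p (insert y S)"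
    and y: "y \<in> V" and e: "0 < e"
  shows "\<exists>\<eta>>0. \<forall>a\<in>V. \<forall>b\<in>V. q (y - a) < \<eta> \<and> q (y + T y - b) < \<eta> \<longrightarrow>
    (\<exists>T'. small (c + e) T' \<and> (\<forall>x. q (T' x - T x) \<le> e * p x) \<and> (\<forall>x\<in>S. T' x = T x) \<and> a + T' a = b)"
proof -
  obtain f :: "'a \<Rightarrow> 'k" and M where M: "0 \<le> M" and fadd: "\<And>x z. f (x + z) = f x + f z"
    and fscale: "\<And>c x. f (sc c x) = c * f x" and fle: "\<And>x. norm (f x) \<le> M * p x"
    and fS: "\<And>a. a \<in> S \<Longrightarrow> f a = 0" and fy: "f y = 1"
    by (rule functional_vanishing_on[OF vector_space_axioms S(1) seminorm_p S(3,2)]) (rule that)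
  \<comment> \<open>The first bound gives M * C * \<eta> \<le> 1/2, so |f a| \<ge> 1/2. The second
    absorbs the resulting factor 2 M of f x / f a and the bound 3 \<eta> for q u. Writing M + 1
    avoids a zero denominator.\<close>
  define \<eta> where "\<eta> = min (1 / (2 * C * (M + 1))) (e / (6 * (M + 1)))"
  have \<eta>: "0 < \<eta>" using M e C_pos by (simp add: \<eta>_def)
  have "\<eta> \<le> 1 / (2 * C * (M + 1))" by (simp add: \<eta>_def)
  moreover have "0 < 2 * C * (M + 1)" using M C_pos by simp
  ultimately have "\<eta> * (2 * C * (M + 1)) \<le> 1" by (simp only: pos_le_divide_eq)
  moreover have "0 \<le> C * \<eta>" using \<eta> C_pos by simp
  ultimately have \<eta>1: "M * (C * \<eta>) \<le> 1 / 2" by (simp add: algebra_simps)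
  have "\<eta> \<le> e / (6 * (M + 1))" by (simp add: \<eta>_def)
  moreover have "0 < 6 * (M + 1)" using M by simp
  ultimately have "\<eta> * (6 * (M + 1)) \<le> e" by (simp only: pos_le_divide_eq)
  then have \<eta>2: "6 * M * \<eta> \<le> e" using \<eta> by (simp add: algebra_simps)
  show ?thesis
  proof (intro exI[of _ \<eta>] conjI \<eta> ballI impI)
    fix a b assume "a \<in> V" "b \<in> V" "q (y - a) < \<eta> \<and> q (y + T y - b) < \<eta>"
    then have a: "a \<in> V" "q (y - a) < \<eta>" and b: "b \<in> V" "q (y + T y - b) < \<eta>" by auto
    have fdiff: "f (x - z) = f x - f z" for x z using fadd[of "x - z" z] by simp
    have "norm (f (y - a)) \<le> M * (C * \<eta>)"
    proof -
      have "p (y - a) \<le> C * q (y - a)" using p_le_q V_diff y a by blast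
      also have "\<dots> \<le> C * \<eta>" using a C_pos by simp
      finally show ?thesis using fle[of "y - a"] M by (meson mult_left_mono order_trans)
    qed
    then have "norm (1 - f a) \<le> 1 / 2" using \<eta>1 by (simp add: fdiff fy)
    moreover have "1 \<le> norm (1 - f a) + norm (f a)"
      using norm_triangle_ineq[of "1 - f a" "f a"] by simp
    ultimately have fa: "1 / 2 \<le> norm (f a)" by simp
    define u where "u = b - (a + T a)"
    have uV: "u \<in> V" unfolding u_def by (intro V_diff V_add a b small_V[OF T(1)])
    define z where "z = y - a"
    have z: "z \<in> V" "q z < \<eta>" using V_diff y a by (auto simp: z_def)
    \<comment> \<open>The three \<eta> come from q z, from q (T z) \<le> q z by c * C \<le> 1, and
      from the error at y.\<close>
    have u: "u = (z + T z) - (y + T y - b)" by (simp add: u_def z_def small_diff[OF T(1)])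
    have w: "y + T y - b \<in> V" by (intro V_diff V_add y b small_V[OF T(1)])
    have "q u \<le> q (z + T z) + q (y + T y - b)"
      using q_add[OF V_add[OF z(1) small_V[OF T(1), of z]] V_neg[OF w]]
      unfolding u q_minus[OF w] diff_conv_add_uminus[of "z + T z"] .
    moreover have "q (z + T z) \<le> q z + q (T z)" using q_add z small_V[OF T(1)] by blast
    moreover have "q (T z) \<le> q z"
      using small_q_le[OF T(1,2) z(1)] mult_right_mono[OF T(3) q_nonneg[OF z(1)]] by simp
    ultimately have qu: "q u \<le> 3 * \<eta>" using z(2) b(2) by simp
    define T' where "T' x = T x + sc (f x / f a) u" for x
    have le: "q (T' x - T x) \<le> e * p x" for x
    proof -
      have "norm (f x) / norm (f a) \<le> (M * p x) / (1 / 2)"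
        using fle[of x] fa M p_nonneg[of x] by (intro frac_le) auto
      then have "norm (f x) / norm (f a) * q u \<le> (2 * (M * p x)) * (3 * \<eta>)"
        using qu q_nonneg[OF uV] M p_nonneg[of x] by (intro mult_mono) auto
      also have "\<dots> = 6 * M * \<eta> * p x" by simp
      also have "\<dots> \<le> e * p x" using \<eta>2 p_nonneg by (rule mult_right_mono)
      finally show ?thesis using q_scale[OF uV] by (simp add: T'_def norm_divide)
    qed
    have T'V: "T' x \<in> V" for x
      unfolding T'_def by (intro V_add V_scale uV small_V[OF T(1)])
    have "small (c + e) T'"
      unfolding small_def
    proof (intro conjI allI)
      show "Vector_Spaces.linear sc sc T'"
      proof (rule linearI)
        show "T' (x + z) = T' x + T' z" for x z
          by (simp add: T'_def small_add[OF T(1)] fadd add_divide_distrib scale_left_distrib algebra_simps)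
        show "T' (sc k x) = sc k (T' x)" for k x
          by (simp add: T'_def small_scale[OF T(1)] fscale scale_right_distrib)
      qed
      fix x
      show "T' x \<in> V" by (rule T'V)
      have "q (T' x) \<le> q (T' x - T x) + q (T x)"
        using q_triangle[OF T'V small_V[OF T(1)] V_0, of x x] by simp
      then show "q (T' x) \<le> (c + e) * p x"
        using le[of x] small_le[OF T(1), of x] by (simp add: algebra_simps)
    qed
    moreover have "\<forall>x\<in>S. T' x = T x" by (simp add: T'_def fS)
    moreover have "f a \<noteq> 0" using fa by auto
    then have "a + T' a = b" by (simp add: T'_def u_def)
    ultimately show "\<exists>T'. small (c + e) T' \<and> (\<forall>x. q (T' x - T x) \<le> e * p x) \<and> (\<forall>x\<in>S. T' x = T x) \<and> a + T' a = b"
      using le by blast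
  qed
qed

end

subsection \<open>Back and forth\<close>

locale dense_pair = normed_subspace +
  fixes A B :: "'b set"
  assumes A_V: "A \<subseteq> V" and B_V: "B \<subseteq> V"
    and dense_A: "x \<in> V \<Longrightarrow> 0 < e \<Longrightarrow> \<exists>a\<in>A. q (x - a) < e"
    and dense_B: "x \<in> V \<Longrightarrow> 0 < e \<Longrightarrow> \<exists>b\<in>B. q (x - b) < e"
    and indep_A: "p_independent sc p A" and indep_B: "p_independent sc p B"
begin

definition partial_match :: "real \<Rightarrow> ('b \<Rightarrow> 'b) \<Rightarrow> 'b set \<Rightarrow> bool" where
  "partial_match c T S \<longleftrightarrow> small c T \<and> finite S \<and> S \<subseteq> A \<and> (\<lambda>x. x + T x) ` S \<subseteq> B"

text \<open>Agreement on S freezes the images already found; the bound on all of X makes the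
  operators converge.\<close>

definition extends :: "real \<Rightarrow> ('b \<Rightarrow> 'b) \<Rightarrow> 'b set \<Rightarrow> ('b \<Rightarrow> 'b) \<Rightarrow> 'b set \<Rightarrow> bool" where
  "extends e T S T' S' \<longleftrightarrow> S \<subseteq> S' \<and> (\<forall>x\<in>S. T' x = T x) \<and> (\<forall>x. q (T' x - T x) \<le> e * p x)"

text \<open>A point already matched uses up its step without changing T. Raising the bound to c + e
  all the same keeps the budget independent of the case.\<close>

lemma partial_match_trivial:
  assumes "partial_match c T S" "0 < e"
  shows "partial_match (c + e) T S \<and> extends e T S T S"
proof
  have "small (c + e) T" using assms by (intro small_mono[of c T "c + e"]) (auto simp: partial_match_def)
  then show "partial_match (c + e) T S" using assms(1) by (simp add: partial_match_def)
  show "extends e T S T S" using assms(2) p_nonneg by (simp add: extends_def q_0)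
qed

text \<open>The source a is exact, so \<open>small_adjust\<close> is used at y = a; density of B
  supplies a target near a + T a.\<close>

lemma partial_match_forth:
  assumes T: "partial_match c T S" "0 \<le> c" "c * C < 1" and e: "0 < e" and a: "a \<in> A"
  obtains T' S' where "partial_match (c + e) T' S'" "extends e T S T' S'" "a \<in> S'"
proof (cases "a \<in> S")
  case True
  then show ?thesis using partial_match_trivial[OF T(1) e] by (intro that[of T S]) auto
next
  case False
  have S: "small c T" "finite S" "S \<subseteq> A" using T(1) by (auto simp: partial_match_def)
  have indep: "p_independent sc p (insert a S)" using p_independent_subset[OF indep_A] S a by blast
  have aV: "a \<in> V" using a A_V by blast
  obtain \<eta> where \<eta>: "0 < \<eta>" "\<forall>a'\<in>V. \<forall>b\<in>V. q (a - a') < \<eta> \<and> q (a + T a - b) < \<eta> \<longrightarrow>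
    (\<exists>T'. small (c + e) T' \<and> (\<forall>x. q (T' x - T x) \<le> e * p x) \<and> (\<forall>x\<in>S. T' x = T x) \<and> a' + T' a' = b)"
    using small_adjust[OF S(1) T(2) less_imp_le[OF T(3)] S(2) False indep aV e] by blast
  obtain b where b: "b \<in> B" "q (a + T a - b) < \<eta>"
    using dense_B[of "a + T a" \<eta>] \<eta>(1) V_add small_V[OF S(1)] a A_V by blast
  then obtain T' where T': "small (c + e) T'" "\<forall>x. q (T' x - T x) \<le> e * p x" "\<forall>x\<in>S. T' x = T x" "a + T' a = b"
    using \<eta>(2)[rule_format, OF aV, of b] \<eta>(1) B_V q_0 by auto
  then have "partial_match (c + e) T' (insert a S)" "extends e T S T' (insert a S)"
    using T(1) a b by (auto simp: partial_match_def extends_def)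
  then show ?thesis by (rule that) simp
qed

text \<open>Now the target b is exact and the source varies: y is the preimage of b, and density of
  A supplies a near y.\<close>

lemma partial_match_back:
  assumes T: "partial_match c T S" "0 \<le> c" "c * C < 1" and e: "0 < e" and b: "b \<in> B"
  obtains T' S' where "partial_match (c + e) T' S'" "extends e T S T' S'" "b \<in> (\<lambda>x. x + T' x) ` S'"
proof (cases "b \<in> (\<lambda>x. x + T x) ` S")
  case True
  then show ?thesis using partial_match_trivial[OF T(1) e] by (intro that[of T S]) auto
next
  case False
  have S: "small c T" "finite S" "S \<subseteq> A" "(\<lambda>x. x + T x) ` S \<subseteq> B"
    using T(1) by (auto simp: partial_match_def)
  have bij: "bij (\<lambda>x. x + T x)" using S(1) T(2,3) by (rule bij_small_perturbation)
  then obtain y where y: "b = y + T y" by (metis bij_pointE)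
  have "y = b - T y" using y by simp
  then have yV: "y \<in> V" using V_diff b B_V small_V[OF S(1)] by (metis subsetD)
  have yS: "y \<notin> S" using False y by blast
  \<comment> \<open>The hypothesis on A says nothing about y, but the current map sends S and y into
    B.\<close>
  have indep: "p_independent sc p (insert y S)"
  proof (rule p_independent_linear_preimage[OF linear_small_perturbation[OF S(1)]])
    show "inj_on (\<lambda>x. x + T x) (insert y S)" using bij by (meson bij_is_inj inj_on_subset subset_UNIV)
    show "p (x + T x) = 0" if "p x = 0" for x using small_eq_0[OF S(1) that] that by simp
    show "p_independent sc p ((\<lambda>x. x + T x) ` insert y S)"
      using p_independent_subset[OF indep_B] S(4) b y by auto
  qed
  obtain \<eta> where \<eta>: "0 < \<eta>" "\<forall>a\<in>V. \<forall>b\<in>V. q (y - a) < \<eta> \<and> q (y + T y - b) < \<eta> \<longrightarrow>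
    (\<exists>T'. small (c + e) T' \<and> (\<forall>x. q (T' x - T x) \<le> e * p x) \<and> (\<forall>x\<in>S. T' x = T x) \<and> a + T' a = b)"
    using small_adjust[OF S(1) T(2) less_imp_le[OF T(3)] S(2) yS indep yV e] by blast
  obtain a where a: "a \<in> A" "q (y - a) < \<eta>" using dense_A[OF yV \<eta>(1)] by blast
  then obtain T' where T': "small (c + e) T'" "\<forall>x. q (T' x - T x) \<le> e * p x" "\<forall>x\<in>S. T' x = T x" "a + T' a = b"
    using \<eta>(2)[rule_format, of a b] \<eta>(1) A_V B_V b q_0 y by auto
  then have "partial_match (c + e) T' (insert a S)" "extends e T S T' (insert a S)"
    using T(1) a b by (auto simp: partial_match_def extends_def)
  then show ?thesis using T'(4) by (intro that) auto
qed

lemma extends_trans: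
  assumes "partial_match a T S" "partial_match b T' S'" "partial_match c T'' S''"
    and "extends e T S T' S'" "extends e' T' S' T'' S''"
  shows "extends (e + e') T S T'' S''"
proof -
  have "q (T'' x - T x) \<le> (e + e') * p x" for x
  proof -
    have "q (T'' x - T x) \<le> q (T'' x - T' x) + q (T' x - T x)"
    proof (rule q_triangle)
      show "T'' x \<in> V" "T' x \<in> V" "T x \<in> V" using assms(1-3) small_V by (auto simp: partial_match_def)
    qed
    also have "\<dots> \<le> e' * p x + e * p x" using assms(4,5) by (intro add_mono) (auto simp: extends_def)
    finally show ?thesis by (simp add: algebra_simps)
  qed
  then show ?thesis using assms(4,5) by (auto simp: extends_def subset_iff)
qed

lemma matching_perturbation:
  assumes "countable A" "A \<noteq> {}" "countable B" "B \<noteq> {}"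
  obtains T where "small (1 / (2 * C)) T" "(\<lambda>x. x + T x) ` A = B"
proof -
  define \<alpha> \<beta> where "\<alpha> = from_nat_into A" and "\<beta> = from_nat_into B"
  have \<alpha>: "range \<alpha> = A" and \<beta>: "range \<beta> = B"
    using assms by (auto simp: \<alpha>_def \<beta>_def range_from_nat_into)
  \<comment> \<open>The bounds c n rise from 0 towards 1/(2C), so c n * C stays below 1/2. The
    increment 2^(-n)/(4C) is 2 d n, shared equally by the forth and the back step.\<close>
  define c where "c n = (1 - (1/2) ^ n) / (2 * C)" for n :: nat
  define d where "d n = (1/2) ^ n / (8 * C)" for n :: nat
  have cS: "c (Suc n) = c n + d n + d n" for n
    using C_pos by (simp add: c_def d_def field_simps)
  have d0: "0 < d n" for n using C_pos by (simp add: d_def)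
  have c0: "0 \<le> c n" for n using C_pos by (simp add: c_def power_le_one)
  have c1: "c n \<le> 1 / (2 * C)" for n using C_pos by (simp add: c_def divide_right_mono)
  have cC: "c n * C < 1" "(c n + d n) * C < 1" for n
  proof -
    have "c (Suc n) * C \<le> 1 / (2 * C) * C" using c1 C_pos by (intro mult_right_mono) auto
    then have "(c n + d n + d n) * C < 1" using C_pos cS by simp
    moreover have "c n * C \<le> (c n + d n + d n) * C" "(c n + d n) * C \<le> (c n + d n + d n) * C"
      using d0[of n] C_pos by (auto intro!: mult_right_mono)
    ultimately show "c n * C < 1" "(c n + d n) * C < 1" by linarith+
  qed
  \<comment> \<open>The pair at \<open>Suc n\<close> has dealt with \<alpha> n and \<beta> n; the
    one at 0 is the zero operator with the empty set, which fits c 0 = 0.\<close>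
  have "\<exists>f. \<forall>n. partial_match (c n) (fst (f n)) (snd (f n)) \<and>
     (extends (d n + d n) (fst (f n)) (snd (f n)) (fst (f (Suc n))) (snd (f (Suc n))) \<and>
      \<alpha> n \<in> snd (f (Suc n)) \<and> \<beta> n \<in> (\<lambda>x. x + fst (f (Suc n)) x) ` snd (f (Suc n)))"
  proof (rule dependent_nat_choice)
    have "small 0 (\<lambda>_. 0)" unfolding small_def using V_0 q_0 by (auto intro!: linearI)
    then have "partial_match (c 0) (\<lambda>_. 0) {}" by (simp add: partial_match_def c_def)
    then show "\<exists>x. partial_match (c 0) (fst x) (snd x)" by auto
  next
    fix x n assume x: "partial_match (c n) (fst x) (snd x)"
    obtain T1 S1 where 1: "partial_match (c n + d n) T1 S1" "extends (d n) (fst x) (snd x) T1 S1" "\<alpha> n \<in> S1"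
      using partial_match_forth[OF x c0 cC(1) d0, of "\<alpha> n"] \<alpha> by blast
    have "0 \<le> c n + d n" using c0[of n] d0[of n] by simp
    then obtain T2 S2 where 2: "partial_match (c n + d n + d n) T2 S2" "extends (d n) T1 S1 T2 S2"
      "\<beta> n \<in> (\<lambda>x. x + T2 x) ` S2"
      using partial_match_back[OF 1(1) _ cC(2) d0, of "\<beta> n"] \<beta> by blast
    have "\<alpha> n \<in> S2" using 1 2 by (auto simp: extends_def)
    then show "\<exists>y. partial_match (c (Suc n)) (fst y) (snd y) \<and>
      (extends (d n + d n) (fst x) (snd x) (fst y) (snd y) \<and>
       \<alpha> n \<in> snd y \<and> \<beta> n \<in> (\<lambda>x. x + fst y x) ` snd y)"
      using extends_trans[OF x 1(1) 2(1) 1(2) 2(2)] 2 cS by (intro exI[of _ "(T2, S2)"]) simp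
  qed
  then obtain f where f: "\<And>n. partial_match (c n) (fst (f n)) (snd (f n))"
     "\<And>n. extends (d n + d n) (fst (f n)) (snd (f n)) (fst (f (Suc n))) (snd (f (Suc n)))"
     "\<And>n. \<alpha> n \<in> snd (f (Suc n))" "\<And>n. \<beta> n \<in> (\<lambda>x. x + fst (f (Suc n)) x) ` snd (f (Suc n))"
    by blast
  define T S where "T n = fst (f n)" and "S n = snd (f n)" for n
  have sm: "small (1 / (2 * C)) (T n)" for n
    using f(1)[of n] small_mono[OF _ c1] by (auto simp: partial_match_def T_def)
  have "summable (\<lambda>n. d n + d n)"
    unfolding d_def by (intro summable_add summable_divide summable_geometric) simp_all
  then obtain T' where T': "small (1 / (2 * C)) T'" and lim: "\<And>x. (\<lambda>n. q (T n x - T' x)) \<longlonglongrightarrow> 0"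
    using small_limit[of "1 / (2 * C)" T "\<lambda>n. d n + d n"] sm f(2) by (auto simp: extends_def T_def)
  have stable: "x \<in> S m \<and> T m x = T n x" if "n \<le> m" "x \<in> S n" for n m x
    using that
  proof (induction m rule: dec_induct)
    case (step m)
    then show ?case using f(2)[of m] by (auto simp: extends_def T_def S_def)
  qed simp
  \<comment> \<open>The values T m x are constant from m = n on, and q separates points of V, so the
    limit is attained at stage n.\<close>
  have eq: "T' x = T n x" if "x \<in> S n" for n x
  proof -
    have "\<forall>\<^sub>F m in sequentially. q (T m x - T' x) = q (T n x - T' x)"
      using stable that unfolding eventually_sequentially by metis
    then have "(\<lambda>m. q (T n x - T' x)) \<longlonglongrightarrow> 0" using lim[of x] by (rule Lim_transform_eventually[rotated])
    then have "q (T n x - T' x) = 0" by (simp add: LIMSEQ_const_iff)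
    then have "T n x - T' x = 0" by (rule q_eq_0D[OF V_diff[OF small_V[OF sm] small_V[OF T']]])
    then show ?thesis by simp
  qed
  have "(\<lambda>x. x + T' x) ` A = B"
  proof (intro equalityI subsetI)
    fix b assume "b \<in> (\<lambda>x. x + T' x) ` A"
    then obtain n where b: "b = \<alpha> n + T' (\<alpha> n)" using \<alpha> by auto
    have "\<alpha> n \<in> S (Suc n)" using f(3) by (simp add: S_def)
    then show "b \<in> B" using b eq f(1)[of "Suc n"] by (auto simp: partial_match_def S_def T_def)
  next
    fix b assume "b \<in> B"
    then obtain n where "b = \<beta> n" using \<beta> by auto
    then obtain x where "x \<in> S (Suc n)" "b = x + T (Suc n) x" using f(4)[of n] by (auto simp: S_def T_def)
    moreover have "x \<in> A" using \<open>x \<in> S (Suc n)\<close> f(1)[of "Suc n"] by (auto simp: partial_match_def S_def)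
    ultimately show "b \<in> (\<lambda>x. x + T' x) ` A" using eq by force
  qed
  then show thesis by (rule that[OF T'])
qed

end

subsection \<open>Disks in locally convex spaces\<close>

lemma vector_space_lcs: "lcs sc \<Longrightarrow> vector_space sc"
  by (simp add: lcs_def)

lemma lcs_continuous_add:
  assumes "lcs (sc :: 'k::real_normed_field \<Rightarrow> 'a::{ab_group_add,t2_space} \<Rightarrow> 'a)"
    and "continuous_on S f" "continuous_on S g"
  shows "continuous_on S (\<lambda>x. f x + g x :: 'a)"
proof -
  have "continuous_on UNIV (\<lambda>z::'a \<times> 'a. fst z + snd z)" using assms(1) by (simp add: lcs_def)
  then have "continuous_on S (\<lambda>x. fst (f x, g x) + snd (f x, g x))"
    by (rule continuous_on_compose2[where f = "\<lambda>x. (f x, g x)"]) (intro continuous_on_Pair assms, simp)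
  then show ?thesis by simp
qed

locale disk_space =
  fixes sc :: "'k::real_normed_field \<Rightarrow> 'a::{ab_group_add,t2_space} \<Rightarrow> 'a" and D :: "'a set"
  assumes lcs: "lcs sc" and disk: "disk sc D" and nonempty: "D \<noteq> {}"
begin

sublocale vector_space sc using lcs by (rule vector_space_lcs)

lemma convexD: "x \<in> D \<Longrightarrow> y \<in> D \<Longrightarrow> 0 \<le> t \<Longrightarrow> t \<le> 1 \<Longrightarrow> sc (of_real t) x + sc (of_real (1 - t)) y \<in> D"
  using disk by (auto simp: disk_def sc_convex_def)

lemma balancedD: "x \<in> D \<Longrightarrow> norm c \<le> 1 \<Longrightarrow> sc c x \<in> D"
  using disk by (auto simp: disk_def sc_balanced_def)

lemma boundedE:
  assumes "open U" "0 \<in> U"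
  obtains s where "0 < s" "\<And>t. s < t \<Longrightarrow> D \<subseteq> sc (of_real t) ` U"
  using disk assms by (auto simp: disk_def tvs_bounded_def)

lemma zero_in_D: "0 \<in> D"
  using nonempty balancedD[of _ 0] by auto

section \<open>The Minkowski functional as a norm on the span of D\<close>

abbreviation "q \<equiv> minkowski sc D"
abbreviation "gauge_set x \<equiv> {t::real. t > 0 \<and> x \<in> sc (of_real t) ` D}"

lemma scale_D_add:
  assumes "0 < r" "0 < s" "x \<in> sc (of_real r) ` D" "y \<in> sc (of_real s) ` D"
  shows "x + y \<in> sc (of_real (r + s)) ` D"
proof -
  obtain u v where uv: "u \<in> D" "x = sc (of_real r) u" "v \<in> D" "y = sc (of_real s) v"
    using assms by blast
  define t where "t = r / (r + s)"
  have t: "0 \<le> t" "t \<le> 1" "(r + s) * t = r" "(r + s) * (1 - t) = s"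
    using assms by (auto simp: t_def field_simps)
  have "sc (of_real (r + s)) (sc (of_real t) u + sc (of_real (1 - t)) v)
     = sc (of_real ((r + s) * t)) u + sc (of_real ((r + s) * (1 - t))) v"
    by (simp only: scale_right_distrib scale_scale of_real_mult)
  also have "\<dots> = x + y" by (simp only: t uv)
  finally have "x + y = sc (of_real (r + s)) (sc (of_real t) u + sc (of_real (1 - t)) v)" ..
  then show ?thesis using convexD[OF uv(1,3) t(1,2)] by blast
qed

lemma scale_D_scale:
  assumes "0 < r" "x \<in> sc (of_real r) ` D" "c \<noteq> 0"
  shows "sc c x \<in> sc (of_real (norm c * r)) ` D"
proof -
  obtain u where u: "u \<in> D" "x = sc (of_real r) u" using assms by blast
  have "sc (c / of_real (norm c)) u \<in> D" using u(1) assms(3) by (intro balancedD) (simp_all add: norm_divide)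
  moreover have "sc c x = sc (of_real (norm c * r)) (sc (c / of_real (norm c)) u)"
    using assms(3) by (simp add: u(2) mult.commute)
  ultimately show ?thesis by blast
qed

lemma scale_D_mono:
  assumes "0 < r" "r \<le> s" "x \<in> sc (of_real r) ` D"
  shows "x \<in> sc (of_real s) ` D"
proof -
  obtain u where u: "u \<in> D" "x = sc (of_real r) u" using assms by blast
  have "sc (of_real (r / s)) u \<in> D" using u(1) assms by (intro balancedD) (simp_all add: norm_divide)
  moreover have "x = sc (of_real s) (sc (of_real (r / s)) u)" using assms by (simp add: u(2))
  ultimately show ?thesis by blast
qed

text \<open>This gives the infimum in \<open>minkowski\<close> its meaning. Span induction works
  because r D + s D is contained in (r + s) D.\<close>

lemma gauge_set_nonempty:
  assumes "x \<in> span D" shows "gauge_set x \<noteq> {}"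
  using assms
proof (induction rule: span_induct_alt)
  case base
  have "0 \<in> sc (of_real 1) ` D" using zero_in_D by force
  then show ?case using zero_less_one by blast
next
  case (step c x y)
  obtain s where s: "0 < s" "y \<in> sc (of_real s) ` D" using step by blast
  have "\<exists>r>0. sc c x \<in> sc (of_real r) ` D"
  proof (cases "c = 0")
    case True
    then show ?thesis using zero_in_D zero_less_one by (metis imageI scale_zero_left scale_zero_right)
  next
    case False
    have "x \<in> sc (of_real 1) ` D" using step by force
    from scale_D_scale[OF _ this False] False show ?thesis by (intro exI[of _ "norm c"]) simp
  qed
  then obtain r where "0 < r" "sc c x \<in> sc (of_real r) ` D" by blast
  then have "r + s > 0 \<and> sc c x + y \<in> sc (of_real (r + s)) ` D" using s scale_D_add[of r s] by simp
  then show ?case by blast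
qed

lemma bdd_below_gauge_set: "bdd_below (gauge_set x)"
  by (rule bdd_belowI[of _ 0]) auto

lemma q_le: "0 < r \<Longrightarrow> x \<in> sc (of_real r) ` D \<Longrightarrow> q x \<le> r"
  unfolding minkowski_def by (rule cInf_lower[OF _ bdd_below_gauge_set]) simp

lemma q_nonneg: "x \<in> span D \<Longrightarrow> 0 \<le> q x"
  unfolding minkowski_def by (rule cInf_greatest[OF gauge_set_nonempty]) auto

lemma q_less:
  assumes "x \<in> span D" "q x < r"
  shows "x \<in> sc (of_real r) ` D"
proof -
  obtain t where t: "t \<in> gauge_set x" "t < r"
    using cInf_lessD[OF gauge_set_nonempty[OF assms(1)]] assms(2) unfolding minkowski_def by blast
  then show ?thesis using scale_D_mono[of t r x] by simp
qed

lemma q_add: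
  assumes "x \<in> span D" "y \<in> span D"
  shows "q (x + y) \<le> q x + q y"
proof (rule field_le_epsilon)
  fix e :: real assume e: "0 < e"
  have pos: "0 < q x + e / 2" "0 < q y + e / 2" using e q_nonneg assms by (simp_all add: add_nonneg_pos)
  have "x + y \<in> sc (of_real ((q x + e / 2) + (q y + e / 2))) ` D"
    using e by (intro scale_D_add pos q_less assms) simp_all
  then have "q (x + y) \<le> (q x + e / 2) + (q y + e / 2)" using pos by (intro q_le) auto
  then show "q (x + y) \<le> q x + q y + e" by simp
qed

lemma q_0: "q 0 = 0"
proof (rule antisym)
  show "q 0 \<le> 0"
  proof (rule field_le_epsilon)
    fix e :: real assume "0 < e"
    moreover have "0 \<in> sc (of_real e) ` D" using zero_in_D by (metis imageI scale_zero_right)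
    ultimately show "q 0 \<le> 0 + e" using q_le by simp
  qed
qed (simp add: q_nonneg span_zero)

lemma q_scale_le:
  assumes "x \<in> span D" "c \<noteq> 0"
  shows "q (sc c x) \<le> norm c * q x"
proof (rule field_le_epsilon)
  fix e :: real assume e: "0 < e"
  define r where "r = q x + e / norm c"
  have r: "0 < r" "q x < r" using e q_nonneg[OF assms(1)] assms(2) by (auto simp: r_def add_nonneg_pos)
  have "q (sc c x) \<le> norm c * r"
    using r assms by (intro q_le scale_D_scale q_less) simp_all
  then show "q (sc c x) \<le> norm c * q x + e" using assms(2) by (simp add: r_def algebra_simps)
qed

lemma q_scale:
  assumes "x \<in> span D"
  shows "q (sc c x) = norm c * q x"
proof (cases "c = 0")
  case False
  have "q (sc (1 / c) (sc c x)) \<le> norm (1 / c) * q (sc c x)"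
    using assms False span_scale by (intro q_scale_le) auto
  then have "norm c * q x \<le> q (sc c x)" using False by (simp add: norm_divide field_simps)
  then show ?thesis using q_scale_le[OF assms False] by simp
qed (simp add: q_0)

text \<open>Boundedness of D is continuity of the inclusion of its span into X. It speaks of t > s
  only, so t = s + 1 is taken.\<close>

lemma neighbourhood_contains_q_ball:
  assumes "open U" "0 \<in> U"
  obtains \<delta> where "0 < \<delta>" "\<And>x. x \<in> span D \<Longrightarrow> q x < \<delta> \<Longrightarrow> x \<in> U"
proof -
  obtain s where s: "0 < s" "\<And>t. s < t \<Longrightarrow> D \<subseteq> sc (of_real t) ` U" using boundedE[OF assms] by blast
  show thesis
  proof (rule that)
    show "0 < 1 / (s + 1)" using s by simp
    fix x assume "x \<in> span D" "q x < 1 / (s + 1)"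
    then obtain u where u: "u \<in> D" "x = sc (of_real (1 / (s + 1))) u" using q_less by blast
    moreover obtain v where "v \<in> U" "u = sc (of_real (s + 1)) v" using s(2)[of "s + 1"] u(1) by auto
    moreover have "1 / (s + 1) * (s + 1) = 1" using s(1) by simp
    then have "of_real (1 / (s + 1)) * of_real (s + 1) = (1 :: 'k)"
      by (metis of_real_1 of_real_mult)
    ultimately show "x \<in> U" by (simp only: scale_scale scale_one)
  qed
qed

text \<open>By boundedness of D, a vector with q x = 0 lies in every neighbourhood of 0; the
  Hausdorff property leaves only x = 0.\<close>

lemma q_eq_0D:
  assumes "x \<in> span D" "q x = 0" shows "x = 0"
proof (rule ccontr)
  assume "x \<noteq> 0"
  then obtain U W where "open U" "open W" "x \<in> W" "0 \<in> U" "U \<inter> W = {}" using hausdorff by metis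
  then show False using neighbourhood_contains_q_ball[of U] assms by (metis disjoint_iff)
qed

lemma continuous_seminorm_le_q:
  assumes "seminorm sc p" "continuous_on UNIV p"
  obtains C where "0 < C" "\<And>x. x \<in> span D \<Longrightarrow> p x \<le> C * q x"
proof -
  have pscale: "p (sc c x) = norm c * p x" for c x using assms(1) by (simp add: seminorm_def)
  have "open (p -` {..<1})" using assms(2) by (intro open_vimage) auto
  moreover have "0 \<in> p -` {..<1}" using pscale[of 0 0] by simp
  ultimately obtain \<delta> where \<delta>: "0 < \<delta>" "\<And>x. x \<in> span D \<Longrightarrow> q x < \<delta> \<Longrightarrow> p x < 1"
    using neighbourhood_contains_q_ball by (metis lessThan_iff vimage_eq)
  show thesis
  proof (rule that)
    show "0 < 2 / \<delta>" using \<delta> by simp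
    fix x assume x: "x \<in> span D"
    have le: "r * p x \<le> 1" if "0 < r" "r * q x < \<delta>" for r
      using \<delta>(2)[OF span_scale[OF x, of "of_real r"]] that by (simp add: q_scale[OF x] pscale)
    show "p x \<le> 2 / \<delta> * q x"
    proof (cases "q x = 0")
      case True
      then have "x = 0" by (rule q_eq_0D[OF x])
      then show ?thesis using pscale[of 0 0] True by simp
    next
      case False
      then have "0 < q x" using q_nonneg[OF x] by simp
      then show ?thesis using le[of "\<delta> / (2 * q x)"] \<delta>(1) by (simp add: field_simps)
    qed
  qed
qed

text \<open>S is continuous from (X, p) to the span with q, and the inclusion of the span into X is
  continuous. Neighbourhoods are controlled at 0 only, hence the translations by z and S z.\<close>

lemma continuous_perturbation:
  assumes p: "seminorm sc p" "continuous_on UNIV p" and S: "\<And>x y. S (x - y) = S x - S y"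
    and V: "\<And>x. S x \<in> span D" and le: "\<And>x. q (S x) \<le> c * p x"
  shows "continuous_on UNIV (\<lambda>x. x + S x)"
proof -
  have p0: "0 \<le> p x" for x using vector_space_axioms p(1) by (rule seminorm_nonneg)
  have "isCont S z" for z
    unfolding isCont_def
  proof (rule topological_tendstoI)
    fix U assume U: "open U" "S z \<in> U"
    have "open ((\<lambda>y. y + S z) -` U)"
      using U(1) by (intro open_vimage lcs_continuous_add[OF lcs]) auto
    then obtain \<delta> where \<delta>: "0 < \<delta>" "\<And>x. x \<in> span D \<Longrightarrow> q x < \<delta> \<Longrightarrow> x + S z \<in> U"
      using neighbourhood_contains_q_ball[of "(\<lambda>y. y + S z) -` U"] U(2) by auto
    \<comment> \<open>The sign of c is not fixed, hence |c|; adding 1 gives a positive denominator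
      and the strict inequality |c| * \<epsilon> < \<delta>.\<close>
    define \<epsilon> where "\<epsilon> = \<delta> / (\<bar>c\<bar> + 1)"
    have "continuous_on UNIV (\<lambda>x. x + - z)"
      by (intro lcs_continuous_add[OF lcs] continuous_intros)
    then have "continuous_on UNIV (\<lambda>x. p (x + - z))"
      by (rule continuous_on_compose2[OF p(2)]) simp
    then have "open ((\<lambda>x. p (x + - z)) -` {..<\<epsilon>})" by (intro open_vimage) auto
    moreover have "p 0 = 0" using p(1) by (metis mult_zero_left norm_zero scale_zero_right seminorm_def)
    then have "z \<in> (\<lambda>x. p (x + - z)) -` {..<\<epsilon>}" using \<delta>(1) by (simp add: \<epsilon>_def)
    moreover have "S x \<in> U" if "x \<in> (\<lambda>x. p (x + - z)) -` {..<\<epsilon>}" for x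
    proof -
      have "q (S (x - z)) \<le> c * p (x - z)" by (rule le)
      also have "\<dots> \<le> \<bar>c\<bar> * p (x - z)" using p0 by (intro mult_right_mono) auto
      also have "\<dots> \<le> \<bar>c\<bar> * \<epsilon>" using that by (intro mult_left_mono) auto
      also have "\<dots> < \<delta>" using \<delta>(1) by (simp add: \<epsilon>_def field_simps)
      finally have "S (x - z) + S z \<in> U" by (intro \<delta>(2) V)
      then show ?thesis by (simp add: S)
    qed
    ultimately show "\<forall>\<^sub>F x in at z. S x \<in> U"
      unfolding eventually_at_topological by blast
  qed
  then show ?thesis
    by (intro lcs_continuous_add[OF lcs] continuous_on_id continuous_at_imp_continuous_on) auto
qed

end

theorem theorem1p5:
  fixes sc :: "'k::real_normed_field \<Rightarrow> 'a::{ab_group_add,t2_space} \<Rightarrow> 'a"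
    and p :: "'a \<Rightarrow> real" and D A B :: "'a set"
  assumes "lcs sc"
    and "seminorm sc p" and "continuous_on UNIV p"
    and "banach_disk sc D"
    and "countable A" and "infinite A" and "countable B" and "infinite B"
    and "p_independent sc p A" and "p_independent sc p B"
    and "dense_in_XD sc D A" and "dense_in_XD sc D B"
  shows "\<exists>J. in_GL sc J \<and> J ` A = B \<and> (\<forall>x. p x = 0 \<longrightarrow> J x = x)"
proof -
  interpret vector_space sc using assms(1) by (rule vector_space_lcs)
  have AB: "A \<subseteq> span D" "B \<subseteq> span D"
    using assms(11,12) by (auto simp: dense_in_XD_def)
  \<comment> \<open>The definition of a disk admits the empty set, but its span {0} has no infinite
    subset.\<close>
  have "D \<noteq> {}" using AB(1) assms(6) finite_subset by fastforce
  then interpret disk_space sc D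
    using assms(1,4) by unfold_locales (auto simp: banach_disk_def)
  obtain C where C: "0 < C" "\<And>x. x \<in> span D \<Longrightarrow> p x \<le> C * minkowski sc D x"
    using continuous_seminorm_le_q[OF assms(2,3)] by blast
  interpret dense_pair sc p "minkowski sc D" "span D" C A B
  proof unfold_locales
    fix s :: "nat \<Rightarrow> 'a"
    assume "\<And>n. s n \<in> span D" "\<And>e. 0 < e \<Longrightarrow> \<exists>N. \<forall>m\<ge>N. \<forall>n\<ge>N. minkowski sc D (s m - s n) < e"
    then show "\<exists>x\<in>span D. (\<lambda>n. minkowski sc D (s n - x)) \<longlonglongrightarrow> 0"
      using assms(4) unfolding banach_disk_def by blast
  qed (use assms C AB q_add q_scale q_eq_0D in \<open>auto simp: dense_in_XD_def\<close>)
  have "A \<noteq> {}" "B \<noteq> {}" using assms by auto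
  then obtain T where T: "small (1 / (2 * C)) T" and image: "(\<lambda>x. x + T x) ` A = B"
    using matching_perturbation assms by blast
  define J where "J = (\<lambda>x. x + T x)"
  have c: "0 \<le> 1 / (2 * C)" "1 / (2 * C) * C < 1" using C(1) by auto
  have bij: "bij J" unfolding J_def using T c by (rule bij_small_perturbation)
  define S where "S = (\<lambda>y. inv J y - y)"
  obtain c' where S: "small c' S"
    using small_inverse_perturbation[OF T c] unfolding S_def J_def by blast
  \<comment> \<open>It is applied to T for J and to S for the inverse, since \<open>inv J y\<close>
    is y + S y.\<close>
  have cont: "continuous_on UNIV (\<lambda>x. x + R x)" if "small k R" for k R
    using that by (intro continuous_perturbation[OF assms(2,3)] small_V small_diff small_le)
  have "continuous_on UNIV (inv J)" using cont[OF S] by (simp add: S_def)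
  then have "in_GL sc J"
    using bij cont[OF T] linear_small_perturbation[OF T] by (simp add: in_GL_def J_def)
  moreover have "J x = x" if "p x = 0" for x
    using small_eq_0[OF T that] by (simp add: J_def)
  ultimately show ?thesis using image unfolding J_def by blast
qed

end
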